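(* Let $\mathbb F$ be a skew field (possibly a field) of characteristic not $2$ that is finite dimensional over its center. Let $a\mapsto a^{\complement}$ be an involutory automorphism of $\mathbb F$ (possibly the identity) and let $a\mapsto a^{\circ}$ be an involutory anti-automorphism of $\mathbb F$ (possibly the identity if $\mathbb F$ is a field). For each matrix $A$ over $\mathbb F$ put $A^{\dagger}:=(A^{\circ})^{\top}$ and $A^{*}:=((A^{\complement})^{\circ})^{\top}$, where $\complement$ and $\circ$ are applied entrywise. Consider a system of matrix equations over $\mathbb F$ $$A_iX_{i'}^{\varepsilon_i}-X_{i''}^{\delta_i}B_i=C_i,\qquad i=1,\dots,s,$$ with unknown matrices $X_1,\dots,X_t$ (of prescribed sizes compatible with the given matrices $A_i,B_i,C_i$), in which $i',i''\in\{1,\dots,t\}$ (indices depending on $i$) and $\varepsilon_i,\delta_i\in\{1,\complement,\dagger,*\}$ for every $i$. This system has a solution if and only if there exist nonsingular matrices $P_1,\dots,P_t$ over $\mathbb F$ such that $$\begin{bmatrix}A_i&0\\0&B_i\end{bmatrix}P_{i'}^{\langle\varepsilon_i\rangle}=P_{i''}^{\langle\delta_i\rangle}\begin{bmatrix}A_i&C_i\\0&B_i\end{bmatrix},\qquad i=1,\dots,s,$$ where $$P^{\langle\sigma\rangle}:=\begin{cases}P^{\sigma}&\text{if }\sigma\in\{1,\complement\},\\ J(P^{\sigma})^{-1}J^{-1}&\text{if }\sigma\in\{\dagger,*\},\end{cases}\qquad J:=\begin{bmatrix}0&I\\-I&0\end{bmatrix}.$$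
   Context: An involutory automorphism of $\mathbb F$ is a bijection $a\mapsto a^{\complement}$ of $\mathbb F$ onto itself with $(a+b)^{\complement}=a^{\complement}+b^{\complement}$, $(ab)^{\complement}=a^{\complement}b^{\complement}$, $(a^{\complement})^{\complement}=a$ for all $a,b\in\mathbb F$. An involutory anti-automorphism of $\mathbb F$ is a bijection $a\mapsto a^{\circ}$ with $(a+b)^{\circ}=a^{\circ}+b^{\circ}$, $(ab)^{\circ}=b^{\circ}a^{\circ}$, $(a^{\circ})^{\circ}=a$ for all $a,b\in\mathbb F$. For a matrix $A$, $A^{1}:=A$, and $A^{\complement}$, $A^{\circ}$ are obtained by applying the map to each entry. Sizes: each unknown $X_j$ has a prescribed size $m_j\times n_j$ (so $X_j^{\sigma}$ is $m_j\times n_j$ for $\sigma\in\{1,\complement\}$ and $n_j\times m_j$ for $\sigma\in\{\dagger,*\}$), and the sizes of $A_i,B_i,C_i$ are such that the equations make sense. The matrix $P_j$ is square of size $(m_j+n_j)\times(m_j+n_j)$, partitioned conformally with $\begin{bmatrix}I_{m_j}&X_j\\0&I_{n_j}\end{bmatrix}$. In the definition of $P_j^{\langle\sigma\rangle}$ with $\sigma\in\{\dagger,*\}$, $J=\begin{bmatrix}0&I_{n_j}\\-I_{m_j}&0\end{bmatrix}$. *)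

theory Defs
  imports "Jordan_Normal_Form.Matrix" "HOL-Computational_Algebra.Computational_Algebra"
begin

definition ring_center :: "'a::ring_1 set" where
  "ring_center = {z. \<forall>a. z * a = a * z}"

text \<open>Finite dimension over the center, as existence of a finite spanning set. The center is
  not a type, so the vector-space classes of the library do not apply.\<close>

definition finite_dim_over_center :: "'a::ring_1 itself \<Rightarrow> bool" where
  "finite_dim_over_center _ \<longleftrightarrow>
     (\<exists>S::'a set. finite S \<and>
        (\<forall>a. \<exists>c. (\<forall>b\<in>S. c b \<in> ring_center) \<and> a = (\<Sum>b\<in>S. c b * b)))"

definition involutory_automorphism :: "('a::ring_1 \<Rightarrow> 'a) \<Rightarrow> bool" where
  "involutory_automorphism f \<longleftrightarrow> bij f \<and>
     (\<forall>a b. f (a + b) = f a + f b) \<and> (\<forall>a b. f (a * b) = f a * f b) \<and> (\<forall>a. f (f a) = a)"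

definition involutory_anti_automorphism :: "('a::ring_1 \<Rightarrow> 'a) \<Rightarrow> bool" where
  "involutory_anti_automorphism f \<longleftrightarrow> bij f \<and>
     (\<forall>a b. f (a + b) = f a + f b) \<and> (\<forall>a b. f (a * b) = f b * f a) \<and> (\<forall>a. f (f a) = a)"

datatype exponent = One | Compl | Dagger | Star

text \<open>In the following, \<open>cmp\<close> is the automorphism and \<open>crc\<close> the anti-automorphism.\<close>

fun mat_exp :: "('a \<Rightarrow> 'a) \<Rightarrow> ('a \<Rightarrow> 'a) \<Rightarrow> 'a mat \<Rightarrow> exponent \<Rightarrow> 'a mat" where
  "mat_exp cmp crc A One = A"
| "mat_exp cmp crc A Compl = map_mat cmp A"
| "mat_exp cmp crc A Dagger = transpose_mat (map_mat crc A)"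
| "mat_exp cmp crc A Star = transpose_mat (map_mat crc (map_mat cmp A))"

text \<open>The numbers of rows and columns of \<open>mat_exp cmp crc X \<sigma>\<close> for \<open>X\<close> of size \<open>m \<times> n\<close>.\<close>

definition exp_rows :: "exponent \<Rightarrow> nat \<Rightarrow> nat \<Rightarrow> nat" where
  "exp_rows \<sigma> m n = (if \<sigma> \<in> {One, Compl} then m else n)"

definition exp_cols :: "exponent \<Rightarrow> nat \<Rightarrow> nat \<Rightarrow> nat" where
  "exp_cols \<sigma> m n = (if \<sigma> \<in> {One, Compl} then n else m)"

text \<open>The two-sided inverse, which is unique; unspecified if \<open>A\<close> is not invertible. The inverse
  operations on matrices in the library are restricted to commutative fields.\<close>

definition mat_inv :: "'a::ring_1 mat \<Rightarrow> 'a mat" where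
  "mat_inv A = (THE B. inverts_mat A B \<and> inverts_mat B A)"

definition J_mat :: "nat \<Rightarrow> nat \<Rightarrow> 'a::ring_1 mat" where
  "J_mat m n = four_block_mat (0\<^sub>m n m) (1\<^sub>m n) (- 1\<^sub>m m) (0\<^sub>m m n)"

text \<open>For \<open>P\<close> of size \<open>(m + n) \<times> (m + n)\<close>.\<close>

definition angle_exp ::
  "('a::ring_1 \<Rightarrow> 'a) \<Rightarrow> ('a \<Rightarrow> 'a) \<Rightarrow> nat \<Rightarrow> nat \<Rightarrow> 'a mat \<Rightarrow> exponent \<Rightarrow> 'a mat" where
  "angle_exp cmp crc m n P \<sigma> =
     (if \<sigma> \<in> {One, Compl} then mat_exp cmp crc P \<sigma>
      else J_mat m n * mat_inv (mat_exp cmp crc P \<sigma>) * mat_inv (J_mat m n))"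

end

theory Submission
  imports Defs "HOL-Library.Function_Algebras"
begin

text \<open>
  Put \<open>Q\<^sub>j\<close> for \<open>P\<^sub>j\<close> raised to \<open>Dagger\<close> in the angle sense. Applying the anti-automorphism to the
  \<open>i\<close>-th matrix identity gives an identity of the same shape for the matrices \<open>Q\<^sub>j\<close>, with \<open>A\<^sub>i\<close>
  and \<open>B\<^sub>i\<close> exchanged. Treating \<open>P\<^sub>j\<close> and \<open>Q\<^sub>j\<close> as independent data gives a doubled system in which
  only automorphisms occur: \<open>cmp\<close> on the \<open>P\<^sub>j\<close> and its conjugate by \<open>crc\<close> on the \<open>Q\<^sub>j\<close>. A solution of
  the doubled system yields one of the original system by averaging, as the characteristic is not 2.

  The doubled system is solved in the way Flanders and Wimmer prove Roth's theorem. Let \<open>D\<^sub>i\<close> and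
  \<open>T\<^sub>i\<close> be the block diagonal and the block triangular matrix of equation \<open>i\<close>. Multiplication by
  the \<open>P\<close>'s maps the families \<open>U\<close> with \<open>D\<^sub>i U = U D\<^sub>i\<close> bijectively onto those with
  \<open>D\<^sub>i U = U T\<^sub>i\<close>. Restriction to the first block column has the same kernel on both, so both have
  the same image by a dimension count, and a family of the second kind with the first block column of
  the identity contains a solution. With two twists, the admissible families form the intersection of
  two additive subgroups which are spaces over two different subfields of the center, each of index
  at most 2. Their intersection may have infinite index, so no dimension count applies. It is replaced
  by two steps: the largest subspaces contained in the two subgroups are made equal by enlarging the
  subgroups, and then Artin's argument on shortest relations reduces the claim to the spans over the
  center.
\<close>

section \<open>Dimension of finitely spanned subspaces\<close>

context vector_space begin

text \<open>In the application the ambient space is infinite dimensional. The finite spanning set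
  \<open>C\<close> keeps bases inside \<open>T\<close> finite, so that \<open>dim\<close> is their
  true size and not the default value of \<open>card\<close> on infinite sets.\<close>

lemma dim_mono_fd:
  assumes "S \<subseteq> T" "T \<subseteq> span C" "finite C"
  shows "dim S \<le> dim T"
proof -
  obtain B where B: "B \<subseteq> S" "independent B" "S \<subseteq> span B" "card B = dim S"
    by (rule basis_exists)
  have "B \<subseteq> T" using B(1) assms(1) by blast
  then obtain B' where B': "B \<subseteq> B'" "B' \<subseteq> T" "independent B'" "T \<subseteq> span B'"
    using maximal_independent_subset_extend[of B T] B(2) by blast
  have "finite B'"
    using independent_span_bound[OF assms(3) B'(3)] B' assms by auto
  then show ?thesis
    using basis_card_eq_dim[OF B'(2,4,3)] B B' card_mono by metis
qed

lemma subspace_dim_equal_fd: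
  assumes "subspace S" "S \<subseteq> T" "T \<subseteq> span C" "finite C" "dim T \<le> dim S"
  shows "S = T"
proof -
  obtain B where B: "B \<subseteq> S" "independent B" "S \<subseteq> span B" "card B = dim S"
    by (rule basis_exists)
  have "B \<subseteq> T" using B(1) assms(2) by blast
  then obtain B' where B': "B \<subseteq> B'" "B' \<subseteq> T" "independent B'" "T \<subseteq> span B'"
    using maximal_independent_subset_extend[of B T] B(2) by blast
  have fin: "finite B'"
    using independent_span_bound[OF assms(4) B'(3)] B' assms by auto
  have "B = B'"
    using card_seteq[OF fin B'(1)] basis_card_eq_dim[OF B'(2,4,3)] B assms by auto
  then show ?thesis
    using B B' assms span_minimal[OF B(1) assms(1)] by auto
qed

text \<open>A basis \<open>A\<close> of the kernel is extended to a basis \<open>B\<close> of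
  \<open>S\<close>; then \<open>f\<close> is injective on \<open>span (B - A)\<close> and maps
  \<open>B - A\<close> to a basis of the image.\<close>

lemma rank_nullity_fd:
  assumes f: "Vector_Spaces.linear scale scale f" and S: "subspace S" and fd: "S \<subseteq> span C" "finite C"
  shows "dim S = dim {v \<in> S. f v = 0} + dim (f ` S)"
proof -
  interpret f: Vector_Spaces.linear scale scale f by (fact f)
  let ?K = "{v \<in> S. f v = 0}"
  obtain A where A: "A \<subseteq> ?K" "independent A" "?K \<subseteq> span A" "card A = dim ?K"
    by (rule basis_exists)
  obtain B where B: "A \<subseteq> B" "B \<subseteq> S" "independent B" "S \<subseteq> span B"
    using maximal_independent_subset_extend[of A S] A(1,2) by blast
  have fin: "finite B"
    using independent_span_bound[OF fd(2) B(3)] B fd by auto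
  have spS: "span (B - A) \<subseteq> S"
    by (rule span_minimal[OF _ S]) (use B in auto)
  have inj: "inj_on f (span (B - A))"
  proof (subst f.inj_on_iff_eq_0[OF subspace_span], intro ballI impI)
    fix v assume v: "v \<in> span (B - A)" "f v = 0"
    then have "v \<in> span A"
      using spS A by auto
    \<comment> \<open>A vector in both spans has its \<open>B\<close>-coordinates supported in
      \<open>A\<close> and in \<open>B - A\<close>, hence all zero.\<close>
    moreover have "span A \<inter> span (B - A) = {0}"
    proof -
      have "representation B w = (\<lambda>_. 0)" if w: "w \<in> span A" "w \<in> span (B - A)" for w
      proof -
        have "representation B w = representation A w"
          using representation_extend[OF B(3) w(1) B(1)] .
        moreover have "representation B w = representation (B - A) w"
          using representation_extend[OF B(3) w(2)] by auto
        ultimately show ?thesis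
          using representation_ne_zero[of A w] representation_ne_zero[of "B - A" w] by fastforce
      qed
      moreover have "w = 0" if "w \<in> span A" "representation B w = (\<lambda>_. 0)" for w
      proof -
        have "w \<in> span B" using that(1) span_mono[OF B(1)] by auto
        from sum_nonzero_representation_eq[OF B(3) this] that(2) show ?thesis by simp
      qed
      ultimately show ?thesis using span_zero by blast
    qed
    ultimately show "v = 0" using v by auto
  qed
  have ind: "independent (f ` (B - A))"
    using f.independent_inj_on_image[OF _ inj] independent_mono[OF B(3)] by auto
  have sub: "f ` (B - A) \<subseteq> f ` S" using B by auto
  have "f ` S \<subseteq> f ` span B" using B by auto
  also have "\<dots> = span (f ` B)" by (rule f.span_image[symmetric])
  also have "\<dots> \<subseteq> span (f ` (B - A))"
  proof (rule span_minimal[OF _ subspace_span], safe)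
    fix b assume b: "b \<in> B"
    show "f b \<in> span (f ` (B - A))"
    proof (cases "b \<in> A")
      case True
      then show ?thesis using A(1) span_zero by auto
    qed (use b in \<open>auto intro: span_base\<close>)
  qed
  finally have "f ` S \<subseteq> span (f ` (B - A))" .
  then have "card (f ` (B - A)) = dim (f ` S)"
    by (rule basis_card_eq_dim[OF sub _ ind])
  moreover have "card (f ` (B - A)) = card (B - A)"
    by (rule card_image) (rule inj_on_subset[OF inj span_superset])
  moreover have "card B = dim S" by (rule basis_card_eq_dim[OF B(2,4,3)])
  moreover have "card B = card A + card (B - A)"
    using B(1) fin by (metis card_Diff_subset card_mono finite_subset le_add_diff_inverse)
  ultimately show ?thesis using A(4) by linarith
qed

end

section \<open>Images of intersections of linked subgroups\<close>

text \<open>If the characteristic is not 2, the fixed field of an involution has this property.\<close>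

definition splits_scalars :: "'z::field set \<Rightarrow> 'z \<Rightarrow> bool" where
  "splits_scalars K \<iota> \<longleftrightarrow> 1 \<in> K \<and> (\<forall>z. \<exists>a\<in>K. \<exists>b\<in>K. z = a + \<iota> * b)"

text \<open>In the intended instance \<open>W\<close> consists of the families \<open>U\<close> with \<open>D\<^sub>i U = U D\<^sub>i\<close>, \<open>th\<close> is
  multiplication by the \<open>P\<close>'s and \<open>pr\<close> keeps the first block column. A pair \<open>linked X0 X\<close> consists of
  subgroups of the two spaces of families.\<close>

locale linked_subgroups = vector_space scale
  for scale :: "'z::field \<Rightarrow> 'b::ab_group_add \<Rightarrow> 'b" (infixr "*s" 75) +
  fixes pr th :: "'b \<Rightarrow> 'b" and W C :: "'b set"
  assumes linear_pr: "Vector_Spaces.linear scale scale pr"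
    and linear_th: "Vector_Spaces.linear scale scale th"
    and pr_idem: "pr (pr v) = pr v"
    and inj_th: "inj_on th W"
    and subspace_W: "subspace W"
    and W_span: "W \<subseteq> span C"
    and finite_C: "finite C"
begin

sublocale pr: Vector_Spaces.linear scale scale pr by (fact linear_pr)
sublocale th: Vector_Spaces.linear scale scale th by (fact linear_th)

text \<open>\<open>X0\<close> stands for families with \<open>D U = U D\<close> and \<open>X\<close>
  for those with \<open>D U = U T\<close>. As \<open>D\<close> and \<open>T\<close> share the first
  block column, \<open>pr\<close> sends both into \<open>X0\<close>; as they share the lower block
  row, a family without first block column satisfies both conditions or neither.\<close>

definition linked :: "'b set \<Rightarrow> 'b set \<Rightarrow> bool" where
  "linked X0 X \<longleftrightarrow> X0 \<subseteq> W \<and> X = th ` X0 \<and> pr ` X0 \<subseteq> X0 \<and> pr ` X \<subseteq> X0 \<and>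
     (\<forall>v. pr v = 0 \<longrightarrow> (v \<in> X \<longleftrightarrow> v \<in> X0))"

lemma linkedD:
  assumes "linked X0 X"
  shows "X0 \<subseteq> W" "X = th ` X0" "v \<in> X0 \<Longrightarrow> pr v \<in> X0" "v \<in> X \<Longrightarrow> pr v \<in> X0"
    "v \<in> X \<Longrightarrow> pr v = 0 \<Longrightarrow> v \<in> X0" "v \<in> X0 \<Longrightarrow> pr v = 0 \<Longrightarrow> v \<in> X"
  using assms unfolding linked_def by blast+

text \<open>The largest subspace contained in an additive subgroup.\<close>

definition core :: "'b set \<Rightarrow> 'b set" where
  "core P = {v. \<forall>z. z *s v \<in> P}"

text \<open>For a subfield \<open>K\<close> these are the \<open>K\<close>-subspaces.\<close>

definition closed_under :: "'z set \<Rightarrow> 'b set \<Rightarrow> bool" where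
  "closed_under K P \<longleftrightarrow> 0 \<in> P \<and> (\<forall>v\<in>P. \<forall>w\<in>P. v + w \<in> P \<and> v - w \<in> P) \<and>
     (\<forall>k\<in>K. \<forall>v\<in>P. k *s v \<in> P)"

lemma closed_underD:
  assumes "closed_under K P"
  shows "0 \<in> P" "v \<in> P \<Longrightarrow> w \<in> P \<Longrightarrow> v + w \<in> P" "v \<in> P \<Longrightarrow> w \<in> P \<Longrightarrow> v - w \<in> P"
    "k \<in> K \<Longrightarrow> v \<in> P \<Longrightarrow> k *s v \<in> P"
  using assms unfolding closed_under_def by auto

lemma closed_under_sum:
  assumes "closed_under K P" "\<And>a. a \<in> t \<Longrightarrow> f a \<in> P"
  shows "sum f t \<in> P"
  using assms(2)
  by (induction t rule: infinite_finite_induct) (auto intro: closed_underD[OF assms(1)])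

text \<open>The dimension count of Flanders and Wimmer: \<open>th\<close> preserves dimension, being
  injective on \<open>W\<close>, and the kernels of \<open>pr\<close> on both sides coincide, so the
  images under \<open>pr\<close> have equal dimension. One contains the other because
  \<open>pr\<close> is idempotent and maps \<open>X\<close> into \<open>X0\<close>.\<close>

lemma linked_subspace:
  assumes l: "linked X0 X" and X0: "subspace X0"
  shows "pr ` X = pr ` X0"
proof -
  have X: "X = th ` X0" and subW: "X0 \<subseteq> W"
    using l by (auto simp: linked_def)
  have sX: "subspace X" unfolding X by (rule th.subspace_image[OF X0])
  have fd0: "X0 \<subseteq> span C" using subW W_span by auto
  have fd: "X \<subseteq> span (th ` C)" unfolding X th.span_image using fd0 by auto
  have "{v \<in> X0. th v = 0} = {0}"
  proof -
    have "v = 0" if "v \<in> X0" "th v = 0" for v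
      using inj_onD[OF inj_th, of v 0] that subW subspace_0[OF subspace_W] th.zero by auto
    then show ?thesis using subspace_0[OF X0] th.zero by blast
  qed
  moreover have "dim {0} = 0"
    using dim_span[of "{}"] dim_eq_card_independent[OF independent_empty] by simp
  ultimately have "dim X = dim X0"
    using rank_nullity_fd[OF linear_th X0 fd0 finite_C] X by simp
  moreover have "{v \<in> X. pr v = 0} = {v \<in> X0. pr v = 0}"
    using linkedD(5,6)[OF l] by blast
  ultimately have d: "dim (pr ` X) = dim (pr ` X0)"
    using rank_nullity_fd[OF linear_pr X0 fd0 finite_C]
      rank_nullity_fd[OF linear_pr sX fd finite_imageI[OF finite_C]] by simp
  have "pr ` X \<subseteq> pr ` X0"
    using l pr_idem unfolding linked_def by (metis image_iff image_subset_iff)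
  moreover have "pr ` X0 \<subseteq> span (pr ` C)" unfolding pr.span_image using fd0 by auto
  ultimately show ?thesis
    using subspace_dim_equal_fd[OF pr.subspace_image[OF sX]] d finite_C by (metis finite_imageI order_refl)
qed

lemma core_subset: "core P \<subseteq> P"
  unfolding core_def using scale_one by (metis (mono_tags, lifting) mem_Collect_eq subsetI)

lemma subspace_core: "closed_under K P \<Longrightarrow> subspace (core P)"
  unfolding subspace_def core_def
  by (auto simp: scale_right_distrib closed_underD)

text \<open>As every scalar is \<open>a + \<iota> * b\<close> with \<open>a\<close>,
  \<open>b\<close> in \<open>K\<close>, closure under \<open>K\<close> leaves only the multiples by
  1 and \<open>\<iota>\<close> to be tested.\<close>

lemma mem_coreI:
  assumes K: "splits_scalars K \<iota>" and P: "closed_under K P" and v: "v \<in> P" "\<iota> *s v \<in> P"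
  shows "v \<in> core P"
  unfolding core_def
proof safe
  fix z
  obtain a b where "a \<in> K" "b \<in> K" "z = a + \<iota> * b"
    using K unfolding splits_scalars_def by blast
  moreover have "(a + \<iota> * b) *s v = a *s v + b *s (\<iota> *s v)"
    by (simp add: scale_left_distrib mult.commute)
  ultimately show "z *s v \<in> P"
    using v closed_underD[OF P] by metis
qed

lemma linked_core:
  assumes "linked P0 P"
  shows "linked (core P0) (core P)"
  unfolding linked_def
proof (intro conjI allI impI)
  have P: "P0 \<subseteq> W" "P = th ` P0" "pr ` P0 \<subseteq> P0" "pr ` P \<subseteq> P0"
    "\<And>v. pr v = 0 \<Longrightarrow> v \<in> P \<longleftrightarrow> v \<in> P0"
    using assms by (auto simp: linked_def)
  show "core P0 \<subseteq> W" using core_subset P by blast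
  show "core P = th ` core P0"
  proof (intro equalityI subsetI)
    fix v assume v: "v \<in> core P"
    then obtain v0 where v0: "v0 \<in> P0" "v = th v0"
      using P(2) core_subset by blast
    \<comment> \<open>Some \<open>w\<close> in \<open>P0\<close> has the same image as
      \<open>z *s v0\<close>; both lie in \<open>W\<close>, where \<open>th\<close> is
      injective.\<close>
    have "z *s v0 \<in> P0" for z
    proof -
      have "th (z *s v0) \<in> th ` P0"
        using v P(2) v0 unfolding core_def by (auto simp: th.scale)
      then obtain w where w: "w \<in> P0" "th w = th (z *s v0)" by force
      then show ?thesis
        using inj_onD[OF inj_th w(2)] P(1) v0 subspace_scale[OF subspace_W] by auto
    qed
    then show "v \<in> th ` core P0" using v0 by (auto simp: core_def)
  qed (use P in \<open>auto simp: core_def simp flip: th.scale\<close>)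
  show "pr ` core P0 \<subseteq> core P0" "pr ` core P \<subseteq> core P0"
    using P by (auto simp: core_def simp flip: pr.scale)
  show "v \<in> core P \<longleftrightarrow> v \<in> core P0" if "pr v = 0" for v
    using P(5)[of "z *s v" for z] that by (auto simp: core_def pr.scale)
qed

lemma linked_Int:
  assumes "linked P0 P" "linked Q0 Q"
  shows "linked (P0 \<inter> Q0) (P \<inter> Q)"
proof -
  note P = linkedD[OF assms(1)] and Q = linkedD[OF assms(2)]
  have "P \<inter> Q = th ` (P0 \<inter> Q0)"
    unfolding P(2) Q(2) by (rule inj_on_image_Int[OF inj_th P(1) Q(1), symmetric])
  then show ?thesis
    unfolding linked_def
  proof (intro conjI)
    show "P0 \<inter> Q0 \<subseteq> W" using P(1) by blast
    show "pr ` (P0 \<inter> Q0) \<subseteq> P0 \<inter> Q0" "pr ` (P \<inter> Q) \<subseteq> P0 \<inter> Q0"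
      using P(3,4) Q(3,4) by auto
    show "\<forall>v. pr v = 0 \<longrightarrow> (v \<in> P \<inter> Q) = (v \<in> P0 \<inter> Q0)"
      using P(5,6) Q(5,6) by auto
  qed
qed

lemma closed_under_Int: "closed_under K P \<Longrightarrow> closed_under K Q \<Longrightarrow> closed_under K (P \<inter> Q)"
  by (auto simp: closed_under_def)

lemma closed_under_core: "closed_under K P \<Longrightarrow> closed_under K' (core P)"
  using subspace_core unfolding closed_under_def
  by (auto intro: subspace_0 subspace_add subspace_diff subspace_scale)

lemma closed_under_th_image:
  assumes "closed_under K P"
  shows "closed_under K (th ` P)"
  using assms unfolding closed_under_def
  by (auto simp: th.zero simp flip: th.add th.diff th.scale intro!: image_eqI[of 0])

lemma linked_closed_under: "linked P0 P \<Longrightarrow> closed_under K P0 \<Longrightarrow> closed_under K P"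
  using closed_under_th_image linkedD(2) by metis

text \<open>Writing \<open>r a = \<alpha> a + \<iota> * \<beta> a\<close> over the subfield, the \<open>\<beta>\<close>-part of a relation is again a
  relation modulo \<open>pr ` core P\<close>, and it is free of those terms whose coefficient lies in the
  subfield.\<close>

lemma split_relation:
  assumes K: "splits_scalars K \<iota>" and P0: "closed_under K P0"
    and cores: "pr ` core P = pr ` core P0" and prc: "pr ` core P \<subseteq> core P0"
    and t: "\<And>a. a \<in> t \<Longrightarrow> pr a \<in> P0" and m: "m \<in> core P"
    and rel: "(\<Sum>a\<in>t. r a *s pr a) + pr m \<in> P0"
  obtains \<beta> n where "n \<in> core P" "(\<Sum>a\<in>t. \<beta> a *s pr a) = pr n"
    "\<And>a. a \<in> t \<Longrightarrow> \<beta> a = 0 \<longleftrightarrow> r a \<in> K"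
proof -
  \<comment> \<open>\<open>splits_scalars\<close> gives no uniqueness, so \<beta> is chosen to be 0
    whenever \<open>r a\<close> lies in \<open>K\<close>. The set \<open>K\<close> is not assumed to
    contain 0, hence the disjunction.\<close>
  have "\<exists>\<alpha> \<beta>. r a = \<alpha> + \<iota> * \<beta> \<and> \<alpha> \<in> K \<and> (\<beta> = 0 \<or> \<beta> \<in> K) \<and> (\<beta> = 0 \<longleftrightarrow> r a \<in> K)" for a
  proof (cases "r a \<in> K")
    case False
    then show ?thesis using K unfolding splits_scalars_def by (metis add.right_neutral mult_zero_right)
  qed (auto intro!: exI[of _ "r a"] exI[of _ 0])
  then obtain \<alpha> \<beta> where ab: "\<And>a. r a = \<alpha> a + \<iota> * \<beta> a" "\<And>a. \<alpha> a \<in> K"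
    "\<And>a. \<beta> a = 0 \<or> \<beta> a \<in> K" "\<And>a. \<beta> a = 0 \<longleftrightarrow> r a \<in> K"
    by metis
  define A B where "A = (\<Sum>a\<in>t. \<alpha> a *s pr a)" and "B = (\<Sum>a\<in>t. \<beta> a *s pr a)"
  have A: "A \<in> P0"
    unfolding A_def using ab t closed_underD[OF P0] by (intro closed_under_sum[OF P0]) auto
  have B: "B \<in> P0"
    unfolding B_def using ab(3) t closed_underD[OF P0]
    by (intro closed_under_sum[OF P0]) (metis scale_zero_left)
  have "pr m \<in> P0" using m prc core_subset by blast
  have "(\<Sum>a\<in>t. r a *s pr a) = A + \<iota> *s B"
    unfolding A_def B_def scale_sum_right
    by (simp add: ab(1) scale_left_distrib sum.distrib)
  \<comment> \<open>\<open>B\<close> and its multiple by \<open>\<iota>\<close> both lie in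
    \<open>P0\<close>, which puts \<open>B\<close> into \<open>core P0\<close>. As \<open>pr\<close>
    fixes \<open>B\<close> and the cores have equal images, \<open>B\<close> is \<open>pr n\<close>
    for some \<open>n\<close> in \<open>core P\<close>.\<close>
  then have "\<iota> *s B = ((\<Sum>a\<in>t. r a *s pr a) + pr m) - (A + pr m)" by simp
  then have "\<iota> *s B \<in> P0"
    using rel A \<open>pr m \<in> P0\<close> closed_underD[OF P0] by metis
  then have "B \<in> core P0" by (rule mem_coreI[OF K P0 B])
  moreover have "pr B = B" unfolding B_def by (simp add: pr.sum pr.scale pr_idem)
  ultimately have "B \<in> pr ` core P" using cores by (metis image_eqI)
  then obtain n where "n \<in> core P" "B = pr n" by blast
  with that[of n \<beta>] ab(4) B_def show ?thesis by blast
qed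

lemma sum_scale_remove:
  assumes "finite t" "b \<in> t" "f b = 0"
  shows "(\<Sum>a\<in>t. f a *s x a) = (\<Sum>a\<in>t - {b}. f a *s x a)"
  using assms by (simp add: sum.remove)

section \<open>Two groups with equal cores: shortening relations\<close>

context
  fixes K1 K2 \<iota>1 \<iota>2 P0 P Q0 Q
  assumes K1: "splits_scalars K1 \<iota>1" and K2: "splits_scalars K2 \<iota>2"
    and lP: "linked P0 P" and lQ: "linked Q0 Q"
    and P0: "closed_under K1 P0" and Q0: "closed_under K2 Q0"
    and cores0: "core P0 = core Q0" and cores: "core P = core Q"
begin

private lemma P: "closed_under K1 P" and Q: "closed_under K2 Q"
  using linked_closed_under lP lQ P0 Q0 by blast+

private lemma pr_core: "pr ` core P = pr ` core P0" "pr ` core P \<subseteq> core P0"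
  by (rule linked_subspace[OF linked_core[OF lP] subspace_core[OF P0]])
    (rule image_subsetI[OF linkedD(4)[OF linked_core[OF lP]]])

text \<open>A coefficient outside \<open>K1 \<inter> K2\<close> misses one of the two sets, and the
  relation is split over that one. Equality of the cores makes the outcome the same in both cases.
  Terms with coefficient 1 drop out since 1 lies in \<open>K1\<close> and \<open>K2\<close>.\<close>

private lemma split_relation_Int:
  assumes "t \<subseteq> P \<inter> Q" "m \<in> core P" "(\<Sum>a\<in>t. r a *s pr a) + pr m \<in> P0 \<inter> Q0"
    and "b \<in> t" "r b \<notin> K1 \<inter> K2"
  obtains \<beta> n where "n \<in> core P" "(\<Sum>a\<in>t. \<beta> a *s pr a) = pr n" "\<beta> b \<noteq> 0"
    "\<And>a. a \<in> t \<Longrightarrow> r a = 1 \<Longrightarrow> \<beta> a = 0"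
proof (cases "r b \<in> K1")
  case False
  have "pr a \<in> P0" if "a \<in> t" for a using that assms(1) linkedD(4)[OF lP] by blast
  from split_relation[OF K1 P0 pr_core this assms(2)] assms(3)
  obtain \<beta> n where n: "n \<in> core P" "(\<Sum>a\<in>t. \<beta> a *s pr a) = pr n"
    "\<And>a. a \<in> t \<Longrightarrow> \<beta> a = 0 \<longleftrightarrow> r a \<in> K1"
    by blast
  show ?thesis
    using that[OF n(1,2)] n(3) False assms(4) K1 by (simp add: splits_scalars_def)
next
  case True
  have "pr a \<in> Q0" if "a \<in> t" for a using that assms(1) linkedD(4)[OF lQ] by blast
  from split_relation[OF K2 Q0 pr_core[unfolded cores0 cores] this assms(2)[unfolded cores]]
    assms(3) obtain \<beta> n where n: "n \<in> core P" "(\<Sum>a\<in>t. \<beta> a *s pr a) = pr n"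
    "\<And>a. a \<in> t \<Longrightarrow> \<beta> a = 0 \<longleftrightarrow> r a \<in> K2"
    unfolding cores by blast
  show ?thesis
    using that[OF n(1,2)] n(3) True assms(4,5) K2 by (simp add: splits_scalars_def)
qed

private lemma combination_mem:
  assumes "t \<subseteq> P \<inter> Q" "m \<in> core P" "\<And>a. a \<in> t \<Longrightarrow> r a \<in> K1 \<inter> K2"
  shows "(\<Sum>a\<in>t. r a *s a) + m \<in> P \<inter> Q"
proof -
  have "m \<in> P \<inter> Q" using assms(2) cores core_subset by blast
  moreover have "(\<Sum>a\<in>t. r a *s a) \<in> P" "(\<Sum>a\<in>t. r a *s a) \<in> Q"
    using assms closed_underD[OF P] closed_underD[OF Q]
    by (auto intro!: closed_under_sum[OF P] closed_under_sum[OF Q])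
  ultimately show ?thesis using closed_underD[OF P] closed_underD[OF Q] by auto
qed

private lemma pr_combination: "pr ((\<Sum>a\<in>t. r a *s a) + m) = (\<Sum>a\<in>t. r a *s pr a) + pr m"
  by (simp add: pr.add pr.sum pr.scale)

private lemma eliminate_term:
  assumes "finite t" "b \<in> t" "\<beta> b \<noteq> 0"
  shows "(\<Sum>a\<in>t. r a *s x a) - (r b / \<beta> b) *s (\<Sum>a\<in>t. \<beta> a *s x a) =
    (\<Sum>a\<in>t - {b}. (r a - r b / \<beta> b * \<beta> a) *s x a)"
proof -
  have "(\<Sum>a\<in>t. r a *s x a) - (r b / \<beta> b) *s (\<Sum>a\<in>t. \<beta> a *s x a) =
      (\<Sum>a\<in>t. (r a - r b / \<beta> b * \<beta> a) *s x a)"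
    by (simp add: scale_left_diff_distrib scale_sum_right sum_subtractf)
  then show ?thesis using assms by (simp add: sum_scale_remove[of t b])
qed

text \<open>Normalise one coefficient to 1. If all others lie in both subfields, the combination is in
  \<open>P \<inter> Q\<close>. Otherwise splitting gives a relation without the normalised term, and subtracting a
  multiple of it removes another term.\<close>

private lemma kernel_combination:
  assumes "finite t" "t \<subseteq> P \<inter> Q" "m \<in> core P" "(\<Sum>a\<in>t. r a *s pr a) + pr m = 0"
  shows "(\<Sum>a\<in>t. r a *s a) + m \<in> span {v \<in> P \<inter> Q. pr v = 0}"
  using assms
proof (induction "card t" arbitrary: t r m rule: less_induct)
  case less
  let ?S = "span {v \<in> P \<inter> Q. pr v = 0}"
  have core: "subspace (core P)" by (rule subspace_core[OF P])
  show ?case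
  proof (cases "\<forall>a\<in>t. r a = 0")
    case True
    then show ?thesis
      using less.prems combination_mem[of "{}" m] by (auto intro: span_base)
  next
    case False
    then obtain b where b: "b \<in> t" "r b \<noteq> 0" by blast
    define r' m' where "r' a = r a / r b" and "m' = (1 / r b) *s m" for a
    have m': "m' \<in> core P" unfolding m'_def using less.prems core by (auto intro: subspace_scale)
    have r'b: "r' b = 1" using b by (simp add: r'_def)
    have rel: "(\<Sum>a\<in>t. r' a *s pr a) + pr m' = 0"
      using arg_cong[OF less.prems(4), of "\<lambda>v. (1 / r b) *s v"]
      by (simp add: r'_def m'_def pr.scale scale_right_distrib scale_sum_right)
    have "(\<Sum>a\<in>t. r' a *s a) + m' \<in> ?S"
    proof (cases "\<forall>a\<in>t. r' a \<in> K1 \<inter> K2")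
      case True
      then show ?thesis
        using combination_mem[OF less.prems(2) m', of r'] rel
        by (auto intro!: span_base simp: pr_combination)
    next
      case False
      then obtain c where c: "c \<in> t" "r' c \<notin> K1 \<inter> K2" by blast
      have "(\<Sum>a\<in>t. r' a *s pr a) + pr m' \<in> P0 \<inter> Q0"
        using rel closed_underD(1)[OF P0] closed_underD(1)[OF Q0] by simp
      from split_relation_Int[OF less.prems(2) m' this c] obtain \<beta> n where
        n: "n \<in> core P" "(\<Sum>a\<in>t. \<beta> a *s pr a) = pr n" and \<beta>: "\<beta> c \<noteq> 0" "\<beta> b = 0"
        using b r'b by metis
      have card: "card (t - {b}) < card t" "card (t - {c}) < card t"
        using b c less.prems(1) by (intro card_Diff1_less; blast)+
      \<comment> \<open>The coefficient of \<open>b\<close> was normalised to 1, so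
        \<open>\<beta> b = 0\<close> and the split relation has fewer terms than the given
        one.\<close>
      have "(\<Sum>a\<in>t - {b}. \<beta> a *s a) + (- n) \<in> ?S"
        using less.prems n \<beta> b core
        by (intro less.hyps[OF card(1)])
          (auto simp: subspace_neg pr.neg sum_scale_remove[of t b \<beta>, symmetric])
      then have w': "(\<Sum>a\<in>t. \<beta> a *s a) - n \<in> ?S"
        using less.prems b \<beta> by (simp add: sum_scale_remove[of t b \<beta>])
      let ?q = "r' c / \<beta> c"
      have shift: "(A + m') - ?q *s (B - n) = (A - ?q *s B) + (m' + ?q *s n)" for A B
        by (simp add: scale_right_diff_distrib)
      \<comment> \<open>Subtracting \<open>?q\<close> times the split relation cancels the term at
        \<open>c\<close>; the multiple of \<open>n\<close> is absorbed into the core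
        element.\<close>
      have "(\<Sum>a\<in>t - {c}. (r' a - ?q * \<beta> a) *s a) + (m' + ?q *s n) \<in> ?S"
      proof (intro less.hyps[OF card(2)])
        show "m' + ?q *s n \<in> core P"
          using m' n core by (auto intro: subspace_add subspace_scale)
        have "(\<Sum>a\<in>t - {c}. (r' a - ?q * \<beta> a) *s pr a) = (\<Sum>a\<in>t. r' a *s pr a) - ?q *s pr n"
          using eliminate_term[of t c \<beta> r' pr, OF less.prems(1) c(1) \<beta>(1)] n(2) by simp
        then show "(\<Sum>a\<in>t - {c}. (r' a - ?q * \<beta> a) *s pr a) + pr (m' + ?q *s n) = 0"
          using rel by (simp add: pr.add pr.scale)
      qed (use less.prems in auto)
      then have "((\<Sum>a\<in>t. r' a *s a) + m') - ?q *s ((\<Sum>a\<in>t. \<beta> a *s a) - n) \<in> ?S"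
        unfolding eliminate_term[of t c \<beta> r' "\<lambda>a. a", OF less.prems(1) c(1) \<beta>(1), symmetric] shift .
      then show ?thesis
        using span_add[OF _ span_scale[OF w', of ?q]] by force
    qed
    then have "r b *s ((\<Sum>a\<in>t. r' a *s a) + m') \<in> ?S" by (rule span_scale)
    then show ?thesis
      using b by (simp add: r'_def m'_def scale_right_distrib scale_sum_right)
  qed
qed

text \<open>As \<open>(\<Sum>a\<in>t. \<beta> a *s pr a) = pr n\<close>, a multiple of the split
  relation can be traded for a change of the core element without altering the value. This removes
  terms until all coefficients lie in both subfields, and then the combination itself is in
  \<open>P \<inter> Q\<close>.\<close>

private lemma image_combination:
  assumes "finite t" "t \<subseteq> P \<inter> Q" "m \<in> core P" "(\<Sum>a\<in>t. r a *s pr a) + pr m \<in> P0 \<inter> Q0"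
  shows "(\<Sum>a\<in>t. r a *s pr a) + pr m \<in> pr ` (P \<inter> Q)"
  using assms
proof (induction "card t" arbitrary: t r m rule: less_induct)
  case less
  show ?case
  proof (cases "\<forall>a\<in>t. r a \<in> K1 \<inter> K2")
    case True
    then show ?thesis
      using combination_mem[OF less.prems(2,3), of r] unfolding pr_combination[symmetric] by auto
  next
    case False
    then obtain c where c: "c \<in> t" "r c \<notin> K1 \<inter> K2" by blast
    from split_relation_Int[OF less.prems(2-4) c] obtain \<beta> n where
      n: "n \<in> core P" "(\<Sum>a\<in>t. \<beta> a *s pr a) = pr n" and \<beta>: "\<beta> c \<noteq> 0" by metis
    have card: "card (t - {c}) < card t"
      using c less.prems(1) by (intro card_Diff1_less)
    let ?q = "r c / \<beta> c"
    have "(\<Sum>a\<in>t - {c}. (r a - ?q * \<beta> a) *s pr a) = (\<Sum>a\<in>t. r a *s pr a) - ?q *s pr n"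
      using eliminate_term[of t c \<beta> r pr, OF less.prems(1) c(1) \<beta>] n(2) by simp
    then have eq: "(\<Sum>a\<in>t - {c}. (r a - ?q * \<beta> a) *s pr a) + pr (m + ?q *s n) =
        (\<Sum>a\<in>t. r a *s pr a) + pr m"
      by (simp add: pr.add pr.scale)
    have "m + ?q *s n \<in> core P"
      using less.prems n subspace_core[OF P] by (auto intro: subspace_add subspace_scale)
    then show ?thesis
      using less.hyps[OF card, of "m + ?q *s n" "\<lambda>a. r a - ?q * \<beta> a"] less.prems unfolding eq by auto
  qed
qed

text \<open>The spans of the two intersections form a linked pair, so the dimension count applies to
  them; \<open>kernel_combination\<close> is what makes their kernels agree.
  \<open>image_combination\<close> then descends from the spans to the groups.\<close>

lemma pr_image_Int_equal_cores: "pr ` (P0 \<inter> Q0) \<subseteq> pr ` (P \<inter> Q)"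
proof -
  let ?G = "P0 \<inter> Q0" and ?H = "P \<inter> Q"
  note lH = linkedD[OF linked_Int[OF lP lQ]]
  have prH: "pr ` ?G \<subseteq> ?G" "pr ` ?H \<subseteq> ?G"
    using lH(3,4) by blast+
  have "linked (span ?G) (span ?H)"
    unfolding linked_def
  proof (intro conjI allI impI)
    show "span ?G \<subseteq> W" by (rule span_minimal[OF lH(1) subspace_W])
    show "span ?H = th ` span ?G" by (simp only: lH(2) th.span_image)
    show "pr ` span ?G \<subseteq> span ?G" "pr ` span ?H \<subseteq> span ?G"
      using prH by (simp_all add: span_mono flip: pr.span_image)
    fix v assume v: "pr v = 0"
    show "v \<in> span ?H \<longleftrightarrow> v \<in> span ?G"
    proof
      assume "v \<in> span ?H"
      then obtain t r where t: "finite t" "t \<subseteq> ?H" "v = (\<Sum>a\<in>t. r a *s a)"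
        unfolding span_explicit by blast
      have "(\<Sum>a\<in>t. r a *s pr a) + pr 0 = 0"
        using v t(3) by (simp add: pr.sum pr.scale pr.zero)
      from kernel_combination[OF t(1,2) subspace_0[OF subspace_core[OF P]] this]
      have "v \<in> span {v \<in> ?H. pr v = 0}" using t(3) by simp
      moreover have "{v \<in> ?H. pr v = 0} \<subseteq> ?G" using lH(5) by auto
      ultimately show "v \<in> span ?G" using span_mono by blast
    next
      assume "v \<in> span ?G"
      \<comment> \<open>For each generator \<open>x\<close> the difference \<open>x - pr x\<close>
        lies in \<open>P0 \<inter> Q0\<close> and in the kernel of \<open>pr\<close>, where the two
        intersections agree.\<close>
      then have "v - pr v \<in> span ?H"
      proof (induction rule: span_induct_alt)
        case base
        then show ?case by (simp add: pr.zero span_zero)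
      next
        case (step c x y)
        have "pr (x - pr x) = 0" by (simp add: pr.diff pr_idem)
        moreover have "x - pr x \<in> ?G"
          using step(1) lH(3)[of x] closed_underD(3)[OF P0] closed_underD(3)[OF Q0] by simp
        ultimately have "x - pr x \<in> ?H" using lH(6) by blast
        then have "c *s (x - pr x) + (y - pr y) \<in> span ?H"
          using step(2) by (intro span_add[OF span_scale[OF span_base]])
        then show ?case by (simp add: pr.add pr.scale algebra_simps)
      qed
      then show "v \<in> span ?H" using v by simp
    qed
  qed
  then have eq: "pr ` span ?H = pr ` span ?G"
    by (rule linked_subspace[OF _ subspace_span])
  show ?thesis
  proof
    fix h assume h: "h \<in> pr ` ?G"
    then have "h \<in> pr ` span ?H"
      unfolding eq using subsetD[OF image_mono[OF span_superset]] by metis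
    then obtain t r where t: "finite t" "t \<subseteq> ?H" "h = pr (\<Sum>a\<in>t. r a *s a)"
      unfolding span_explicit by blast
    then have hs: "h = (\<Sum>a\<in>t. r a *s pr a) + pr 0"
      by (simp add: pr.sum pr.scale pr.zero)
    have "h \<in> ?G" using h prH by (metis subsetD)
    then show "h \<in> pr ` ?H"
      using image_combination[OF t(1,2) subspace_0[OF subspace_core[OF P]], of r] hs by simp
  qed
qed

end

text \<open>The case of a single twist, obtained by taking both pairs equal.\<close>

lemma pr_image_closed:
  assumes "splits_scalars K \<iota>" "linked P0 P" "closed_under K P0"
  shows "pr ` P0 \<subseteq> pr ` P"
  using pr_image_Int_equal_cores[OF assms(1,1,2,2,3,3)] by simp

section \<open>Enlarging one group by the core of the other\<close>

definition set_sum :: "'b set \<Rightarrow> 'b set \<Rightarrow> 'b set" where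
  "set_sum X Y = {x + y | x y. x \<in> X \<and> y \<in> Y}"

lemma set_sumI: "x \<in> X \<Longrightarrow> y \<in> Y \<Longrightarrow> x + y \<in> set_sum X Y"
  unfolding set_sum_def by blast

lemma set_sum_subset_W: "X \<subseteq> W \<Longrightarrow> Y \<subseteq> W \<Longrightarrow> set_sum X Y \<subseteq> W"
  unfolding set_sum_def using subspace_add[OF subspace_W] by auto

lemma closed_under_set_sum:
  assumes "closed_under K X" "closed_under K Y"
  shows "closed_under K (set_sum X Y)"
proof -
  have "0 \<in> set_sum X Y"
    unfolding set_sum_def using closed_underD(1)[OF assms(1)] closed_underD(1)[OF assms(2)] by force
  moreover have "v + w \<in> set_sum X Y \<and> v - w \<in> set_sum X Y"
    if "v \<in> set_sum X Y" "w \<in> set_sum X Y" for v w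
  proof -
    from that obtain x y x' y' where *: "v = x + y" "w = x' + y'" "x \<in> X" "y \<in> Y" "x' \<in> X" "y' \<in> Y"
      unfolding set_sum_def by blast
    have "v + w = (x + x') + (y + y')" "v - w = (x - x') + (y - y')" using * by auto
    moreover have "x + x' \<in> X" "y + y' \<in> Y" "x - x' \<in> X" "y - y' \<in> Y"
      using * closed_underD(2,3)[OF assms(1)] closed_underD(2,3)[OF assms(2)] by simp_all
    ultimately show ?thesis unfolding set_sum_def by blast
  qed
  moreover have "k *s v \<in> set_sum X Y" if "k \<in> K" "v \<in> set_sum X Y" for k v
    using that closed_underD(4)[OF assms(1)] closed_underD(4)[OF assms(2)] unfolding set_sum_def
    by (force simp: scale_right_distrib)
  ultimately show ?thesis by (auto simp: closed_under_def)
qed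

text \<open>Enlarging \<open>Q\<close> by \<open>core P\<close> preserves the assumptions, and by \<open>pr_image_Int_of_set_sum_core\<close> the
  claim for the enlarged group implies the one for \<open>Q\<close>. Since the dimensions of the cores grow, this
  can be repeated until the cores agree.\<close>

lemma linked_set_sum_core:
  assumes K2: "splits_scalars K2 \<iota>2" and lP: "linked P0 P" and lQ: "linked Q0 Q"
    and P0: "closed_under K1 P0" and Q0: "closed_under K2 Q0"
  shows "linked (set_sum Q0 (core P0)) (set_sum Q (core P))"
    and "pr ` (Q0 \<inter> core P0) \<subseteq> pr ` (Q \<inter> core P)"
proof -
  let ?M = "core P0" and ?N = "core P"
  note lN = linked_core[OF lP]
  have N0: "closed_under K2 ?M" by (rule closed_under_core[OF P0])
  have Q: "closed_under K2 Q" and N: "closed_under K2 ?N"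
    using linked_closed_under lQ lN Q0 N0 by blast+
  show im: "pr ` (Q0 \<inter> ?M) \<subseteq> pr ` (Q \<inter> ?N)"
    by (rule pr_image_closed[OF K2 linked_Int[OF lQ lN] closed_under_Int[OF Q0 N0]])
  show "linked (set_sum Q0 ?M) (set_sum Q ?N)"
    unfolding linked_def
  proof (intro conjI allI impI)
    show "set_sum Q0 ?M \<subseteq> W"
      by (rule set_sum_subset_W[OF linkedD(1)[OF lQ] linkedD(1)[OF lN]])
    show "set_sum Q ?N = th ` set_sum Q0 ?M"
      unfolding set_sum_def linkedD(2)[OF lQ] linkedD(2)[OF lN] by (force simp: th.add)
    show "pr ` set_sum Q0 ?M \<subseteq> set_sum Q0 ?M" "pr ` set_sum Q ?N \<subseteq> set_sum Q0 ?M"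
      using linkedD(3,4)[OF lQ] linkedD(3,4)[OF lN] unfolding set_sum_def by (force simp: pr.add)+
    fix v assume v: "pr v = 0"
    show "v \<in> set_sum Q ?N \<longleftrightarrow> v \<in> set_sum Q0 ?M"
    proof
      assume "v \<in> set_sum Q ?N"
      then obtain q n where qn: "v = q + n" "q \<in> Q" "n \<in> ?N" by (auto simp: set_sum_def)
      \<comment> \<open>\<open>q\<close> and \<open>n\<close> need not lie in the kernel separately.
        Since \<open>pr q = - pr n\<close> belongs to \<open>Q0\<close> and to
        \<open>core P0\<close>, it is \<open>pr s\<close> for some \<open>s\<close> in
        \<open>Q \<inter> core P\<close>, and shifting \<open>s\<close> from \<open>q\<close> to
        \<open>n\<close> puts both summands into the kernel.\<close>
      have "pr q = - pr n" using v qn by (simp add: pr.add eq_neg_iff_add_eq_0)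
      moreover have "pr q \<in> Q0" "pr n \<in> ?M" using qn linkedD(4)[OF lQ] linkedD(4)[OF lN] by auto
      ultimately have "pr q \<in> Q0 \<inter> ?M"
        using subspace_neg[OF subspace_core[OF P0]] by simp
      then have "pr q \<in> pr ` (Q \<inter> ?N)" using im pr_idem by (metis image_eqI subsetD)
      then obtain s where s: "s \<in> Q" "s \<in> ?N" "pr q = pr s" by blast
      have "pr (q - s) = 0" "pr (n + s) = 0"
        using s v qn by (simp_all add: pr.diff pr.add add.commute)
      moreover have "q - s \<in> Q" "n + s \<in> ?N"
        using s qn closed_underD[OF Q] closed_underD[OF N] by auto
      ultimately have "q - s \<in> Q0" "n + s \<in> ?M" using linkedD(5)[OF lQ] linkedD(5)[OF lN] by auto
      moreover have "v = (q - s) + (n + s)" using qn by simp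
      ultimately show "v \<in> set_sum Q0 ?M" unfolding set_sum_def by blast
    next
      assume "v \<in> set_sum Q0 ?M"
      then obtain q n where qn: "v = q + n" "q \<in> Q0" "n \<in> ?M" by (auto simp: set_sum_def)
      \<comment> \<open>The truncations cancel in the sum because \<open>pr v = 0\<close>, and each
        remainder is a kernel vector.\<close>
      have "q - pr q \<in> Q0" "n - pr n \<in> ?M"
        using qn linkedD(3)[OF lQ] linkedD(3)[OF lN] closed_underD[OF Q0] closed_underD[OF N0] by auto
      moreover have "pr (q - pr q) = 0" "pr (n - pr n) = 0" by (simp_all add: pr.diff pr_idem)
      ultimately have "q - pr q \<in> Q" "n - pr n \<in> ?N" using linkedD(6)[OF lQ] linkedD(6)[OF lN] by auto
      moreover have "v = (q - pr q) + (n - pr n)"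
        using qn v by (simp add: pr.add algebra_simps)
      ultimately show "v \<in> set_sum Q ?N" unfolding set_sum_def by blast
    qed
  qed
qed

text \<open>Given \<open>h = pr (q + n)\<close> with \<open>n\<close> in \<open>core P\<close>, the
  element \<open>pr n\<close> lies in \<open>Q0 \<inter> core P0\<close> and so equals
  \<open>pr s\<close> with \<open>s\<close> in \<open>Q \<inter> core P\<close>. Replacing
  \<open>n\<close> by \<open>s\<close> keeps the image and moves the preimage into
  \<open>P \<inter> Q\<close>.\<close>

lemma pr_image_Int_of_set_sum_core:
  assumes K2: "splits_scalars K2 \<iota>2" and lP: "linked P0 P" and lQ: "linked Q0 Q"
    and P0: "closed_under K1 P0" and Q0: "closed_under K2 Q0"
    and im: "pr ` (P0 \<inter> set_sum Q0 (core P0)) \<subseteq> pr ` (P \<inter> set_sum Q (core P))"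
  shows "pr ` (P0 \<inter> Q0) \<subseteq> pr ` (P \<inter> Q)"
proof
  fix h assume "h \<in> pr ` (P0 \<inter> Q0)"
  then have h: "h \<in> P0" "h \<in> Q0" "pr h = h"
    using linkedD(3)[OF lP] linkedD(3)[OF lQ] pr_idem by auto
  have P: "closed_under K1 P" and Q: "closed_under K2 Q"
    using linked_closed_under lP lQ P0 Q0 by blast+
  have "h = h + 0" "0 \<in> core P0" using subspace_0[OF subspace_core[OF P0]] by auto
  then have "h \<in> set_sum Q0 (core P0)" using h(2) unfolding set_sum_def by blast
  then have "h \<in> pr ` (P \<inter> set_sum Q (core P))" using im h by (metis IntI image_eqI subsetD)
  then obtain q n where qn: "h = pr (q + n)" "q + n \<in> P" "q \<in> Q" "n \<in> core P"
    unfolding set_sum_def by blast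
  have "n \<in> P" using qn(4) core_subset by blast
  then have q: "q \<in> P" using closed_underD(3)[OF P qn(2)] by fastforce
  have "pr q \<in> Q0" "pr n \<in> core P0" using qn linkedD(4)[OF lQ] linkedD(4)[OF linked_core[OF lP]] by auto
  moreover have "pr n = h - pr q" using qn(1) by (simp add: pr.add)
  ultimately have "pr n \<in> Q0 \<inter> core P0" using h closed_underD[OF Q0] by auto
  then have "pr n \<in> pr ` (Q \<inter> core P)"
    using linked_set_sum_core(2)[OF K2 lP lQ P0 Q0] pr_idem by (metis image_eqI subsetD)
  then obtain s where s: "s \<in> Q" "s \<in> core P" "pr n = pr s" by blast
  have "s \<in> P" using s core_subset by blast
  then have "q + s \<in> P \<inter> Q" using q qn s closed_underD[OF P] closed_underD[OF Q] by auto
  moreover have "h = pr (q + s)" using qn(1) s by (simp add: pr.add)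
  ultimately show "h \<in> pr ` (P \<inter> Q)" by blast
qed

text \<open>The enlarged core contains both old cores, hence is strictly larger than
  \<open>core Q0\<close>, and it stays inside \<open>W\<close>. This decrease makes the enlarging
  stop.\<close>

lemma dim_core_set_sum:
  assumes P0: "closed_under K1 P0" and Q0: "closed_under K2 Q0" and W: "P0 \<subseteq> W" "Q0 \<subseteq> W"
    and "\<not> core P0 \<subseteq> core Q0"
  shows "dim W - dim (core (set_sum Q0 (core P0))) < dim W - dim (core Q0)"
proof -
  let ?X = "core (set_sum Q0 (core P0))"
  have sX: "subspace ?X"
    by (rule subspace_core[OF closed_under_set_sum[OF Q0 closed_under_core[OF P0]]])
  have "set_sum Q0 (core P0) \<subseteq> W"
    by (rule set_sum_subset_W[OF W(2) order_trans[OF core_subset W(1)]])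
  then have XW: "?X \<subseteq> W" by (rule order_trans[OF core_subset])
  have "core Q0 \<subseteq> ?X"
  proof
    fix v assume v: "v \<in> core Q0"
    have "z *s v + 0 \<in> set_sum Q0 (core P0)" for z
      using v subspace_0[OF subspace_core[OF P0]] unfolding core_def[of Q0] by (intro set_sumI) auto
    then show "v \<in> ?X" by (simp add: core_def)
  qed
  have "core P0 \<subseteq> ?X"
  proof
    fix v assume "v \<in> core P0"
    then have "z *s v \<in> core P0" for z by (rule subspace_scale[OF subspace_core[OF P0]])
    then have "0 + z *s v \<in> set_sum Q0 (core P0)" for z
      by (rule set_sumI[OF closed_underD(1)[OF Q0]])
    then show "v \<in> ?X" by (simp add: core_def)
  qed
  then have "core Q0 \<noteq> ?X" using assms(5) by blast
  then have "dim (core Q0) < dim ?X"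
    using subspace_dim_equal_fd[OF subspace_core[OF Q0] \<open>core Q0 \<subseteq> ?X\<close> _ finite_C] XW W_span
    by (meson not_less order_trans)
  moreover have "dim ?X \<le> dim W" by (rule dim_mono_fd[OF XW W_span finite_C])
  ultimately show ?thesis by linarith
qed

text \<open>Induction on the total codimension of the two cores in \<open>W\<close>. If one core is
  not contained in the other, the group of the other is enlarged by it; if neither case occurs, the
  cores agree.\<close>

theorem pr_image_Int:
  assumes "splits_scalars K1 \<iota>1" "splits_scalars K2 \<iota>2" "linked P0 P" "linked Q0 Q"
    and "closed_under K1 P0" "closed_under K2 Q0"
  shows "pr ` (P0 \<inter> Q0) \<subseteq> pr ` (P \<inter> Q)"
  using assms
proof (induction "(dim W - dim (core P0)) + (dim W - dim (core Q0))" arbitrary: P0 P Q0 Q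
    rule: less_induct)
  case less
  note K1 = less.prems(1) and K2 = less.prems(2) and lP = less.prems(3) and lQ = less.prems(4)
    and P0 = less.prems(5) and Q0 = less.prems(6)
  have W: "P0 \<subseteq> W" "Q0 \<subseteq> W" by (rule linkedD(1)[OF lP], rule linkedD(1)[OF lQ])
  consider "\<not> core P0 \<subseteq> core Q0" | "\<not> core Q0 \<subseteq> core P0" | "core P0 = core Q0" by blast
  then show ?case
  proof cases
    case 1
    have "pr ` (P0 \<inter> set_sum Q0 (core P0)) \<subseteq> pr ` (P \<inter> set_sum Q (core P))"
      using dim_core_set_sum[OF P0 Q0 W 1]
      by (intro less.hyps[OF _ K1 K2 lP linked_set_sum_core(1)[OF K2 lP lQ P0 Q0] P0
            closed_under_set_sum[OF Q0 closed_under_core[OF P0]]]) auto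
    then show ?thesis by (rule pr_image_Int_of_set_sum_core[OF K2 lP lQ P0 Q0])
  next
    case 2
    have "pr ` (set_sum P0 (core Q0) \<inter> Q0) \<subseteq> pr ` (set_sum P (core Q) \<inter> Q)"
      using dim_core_set_sum[OF Q0 P0 W(2,1) 2]
      by (intro less.hyps[OF _ K1 K2 linked_set_sum_core(1)[OF K1 lQ lP Q0 P0] lQ
            closed_under_set_sum[OF P0 closed_under_core[OF Q0]] Q0]) auto
    then show ?thesis
      using pr_image_Int_of_set_sum_core[OF K1 lQ lP Q0 P0] by (simp add: Int_commute)
  next
    case 3
    have "core P = core Q"
      using linkedD(2)[OF linked_core[OF lP]] linkedD(2)[OF linked_core[OF lQ]] 3 by simp
    then show ?thesis by (rule pr_image_Int_equal_cores[OF K1 K2 lP lQ P0 Q0 3])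
  qed
qed

end

section \<open>The center as a field\<close>

text \<open>As a type, the center can serve as the scalar field of the families, and the dimension
  theory of \<open>vector_space\<close> applies over it.\<close>

typedef (overloaded) 'a center = "ring_center :: 'a::division_ring set"
  morphisms of_center to_center
  by (auto simp: ring_center_def intro!: exI[of _ 0])

lemma of_center_commute: "of_center z * a = a * of_center (z :: 'a::division_ring center)"
  using of_center[of z] by (simp add: ring_center_def)

instantiation center :: (division_ring) field
begin

definition "0 = to_center 0"
definition "1 = to_center 1"
definition "x + y = to_center (of_center x + of_center y)"
definition "x - y = to_center (of_center x - of_center y)"
definition "- x = to_center (- of_center x)"
definition "x * y = to_center (of_center x * of_center y)"
definition "inverse x = to_center (inverse (of_center x))"
definition divide_center :: "'a center \<Rightarrow> 'a center \<Rightarrow> 'a center" where "divide_center x y = x * inverse y"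

lemma of_center_0 [simp]: "of_center 0 = 0"
  and of_center_1 [simp]: "of_center 1 = 1"
  and of_center_add [simp]: "of_center (x + y) = of_center x + of_center y"
  and of_center_diff [simp]: "of_center (x - y) = of_center x - of_center y"
  and of_center_minus [simp]: "of_center (- x) = - of_center x"
  and of_center_mult [simp]: "of_center (x * y) = of_center x * of_center y"
  and of_center_inverse [simp]: "of_center (inverse x) = inverse (of_center x)"
proof -
  have comm: "of_center x * a = a * of_center x" for x a
    by (rule of_center_commute)
  show "of_center 0 = 0" "of_center 1 = 1"
    by (simp_all add: zero_center_def one_center_def to_center_inverse ring_center_def)
  show "of_center (x + y) = of_center x + of_center y" "of_center (x - y) = of_center x - of_center y"
    "of_center (- x) = - of_center x"
    by (simp_all add: plus_center_def minus_center_def uminus_center_def to_center_inverse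
        ring_center_def distrib_left distrib_right left_diff_distrib right_diff_distrib comm)
  have "of_center x * of_center y * a = a * (of_center x * of_center y)" for a
    by (metis comm mult.assoc)
  then show "of_center (x * y) = of_center x * of_center y"
    by (simp add: times_center_def to_center_inverse ring_center_def)
  have "inverse (of_center x) * a = a * inverse (of_center x)" for a
    by (cases "of_center x = 0") (simp_all add: comm[of x a] mult_commute_imp_mult_inverse_commute)
  then show "of_center (inverse x) = inverse (of_center x)"
    by (simp add: inverse_center_def to_center_inverse ring_center_def)
qed

instance
proof
  fix x y z :: "'a center"
  note inj = of_center_inject[symmetric]
  show "x * y * z = x * (y * z)" "x + y + z = x + (y + z)" "0 + x = x" "- x + x = 0" "x - y = x + - y"
    "1 * x = x" "(x + y) * z = x * z + y * z" "(0 :: 'a center) \<noteq> 1"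
    by (simp_all add: inj mult.assoc add.assoc distrib_right)
  show "x + y = y + x" by (simp add: inj add.commute)
  show "x * y = y * x" by (metis of_center_inject of_center_mult of_center_commute)
  show "x \<noteq> 0 \<Longrightarrow> inverse x * x = 1" by (simp add: inj)
  show "x div y = x * inverse y" by (simp add: divide_center_def)
  show "inverse (0 :: 'a center) = 0" by (simp add: inj)
qed

end

section \<open>Infinite matrices with finite support\<close>

text \<open>Matrices of different sizes are padded with zeros to functions on pairs of indices, so that
  families of them form a vector space.\<close>

definition mult_fun :: "nat \<Rightarrow> (nat \<Rightarrow> nat \<Rightarrow> 'a::ring_1) \<Rightarrow> (nat \<Rightarrow> nat \<Rightarrow> 'a) \<Rightarrow> nat \<Rightarrow> nat \<Rightarrow> 'a" where
  "mult_fun N f g = (\<lambda>r c. \<Sum>k<N. f r k * g k c)"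

lemma mult_fun_assoc: "mult_fun N (mult_fun N f g) h = mult_fun N f (mult_fun N g h)"
  unfolding mult_fun_def sum_distrib_left sum_distrib_right
  by (intro ext, subst sum.swap) (simp add: mult.assoc)

definition unit_fun :: "nat \<Rightarrow> nat \<Rightarrow> nat \<Rightarrow> 'a::ring_1" where
  "unit_fun d r c = (if r = c \<and> r < d then 1 else 0)"

definition supported :: "nat \<Rightarrow> nat \<Rightarrow> (nat \<Rightarrow> nat \<Rightarrow> 'a::ring_1) \<Rightarrow> bool" where
  "supported a b f \<longleftrightarrow> (\<forall>r c. \<not> (r < a \<and> c < b) \<longrightarrow> f r c = 0)"

lemma mult_fun_unit_right:
  assumes "supported a b f" "b \<le> N"
  shows "mult_fun N f (unit_fun b) = f"
proof (intro ext)
  fix r c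
  have "mult_fun N f (unit_fun b) r c = (\<Sum>k<N. if k = c then f r c else 0)"
    unfolding mult_fun_def unit_fun_def using assms by (intro sum.cong) (auto simp: supported_def)
  also have "\<dots> = f r c" using assms by (auto simp: supported_def)
  finally show "mult_fun N f (unit_fun b) r c = f r c" .
qed

lemma mult_fun_unit_left:
  assumes "supported a b f" "a \<le> N"
  shows "mult_fun N (unit_fun a) f = f"
proof (intro ext)
  fix r c
  have "mult_fun N (unit_fun a) f r c = (\<Sum>k<N. if k = r then f r c else 0)"
    unfolding mult_fun_def unit_fun_def using assms by (intro sum.cong) (auto simp: supported_def)
  also have "\<dots> = f r c" using assms by (auto simp: supported_def)
  finally show "mult_fun N (unit_fun a) f r c = f r c" .
qed

lemma supported_mult_fun: "supported a b f \<Longrightarrow> supported b c g \<Longrightarrow> supported a c (mult_fun N f g)"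
  unfolding supported_def mult_fun_def by (auto intro!: sum.neutral)

definition ring_hom_fun :: "('a::ring_1 \<Rightarrow> 'a) \<Rightarrow> bool" where
  "ring_hom_fun \<phi> \<longleftrightarrow> \<phi> 1 = 1 \<and> (\<forall>a b. \<phi> (a + b) = \<phi> a + \<phi> b) \<and> (\<forall>a b. \<phi> (a * b) = \<phi> a * \<phi> b)"

lemma ring_hom_funD:
  assumes "ring_hom_fun \<phi>"
  shows "\<phi> 1 = 1" "\<phi> 0 = 0" "\<phi> (a + b) = \<phi> a + \<phi> b" "\<phi> (a * b) = \<phi> a * \<phi> b"
    "\<phi> (a - b) = \<phi> a - \<phi> b" "\<phi> (- a) = - \<phi> a" "\<phi> (sum f A) = (\<Sum>x\<in>A. \<phi> (f x))"
proof -
  have add: "\<phi> (a + b) = \<phi> a + \<phi> b" for a b using assms by (auto simp: ring_hom_fun_def)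
  show zero: "\<phi> 0 = 0" using add[of 0 0] by simp
  show min: "\<phi> (- a) = - \<phi> a" for a using add[of "- a" a] zero by (simp add: eq_neg_iff_add_eq_0)
  show "\<phi> (a - b) = \<phi> a - \<phi> b" using add[of a "- b"] min by simp
  show "\<phi> (sum f A) = (\<Sum>x\<in>A. \<phi> (f x))"
    by (induction A rule: infinite_finite_induct) (auto simp: zero add)
qed (use assms in \<open>auto simp: ring_hom_fun_def\<close>)

lemma map_mult_fun:
  "ring_hom_fun \<phi> \<Longrightarrow> (\<lambda>r c. \<phi> (mult_fun N f g r c)) = mult_fun N (\<lambda>r c. \<phi> (f r c)) (\<lambda>r c. \<phi> (g r c))"
  unfolding mult_fun_def by (simp add: ring_hom_funD)

lemma map_unit_fun: "ring_hom_fun \<phi> \<Longrightarrow> (\<lambda>r c. \<phi> (unit_fun d r c)) = unit_fun d"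
  unfolding unit_fun_def by (auto simp: fun_eq_iff ring_hom_funD)

section \<open>Families as vector spaces over the center\<close>

definition center_scale :: "'a::division_ring center \<Rightarrow> ('k \<Rightarrow> 'a) \<Rightarrow> 'k \<Rightarrow> 'a" where
  "center_scale z u = (\<lambda>k. of_center z * u k)"

lemma vector_space_center_scale: "vector_space center_scale"
  by unfold_locales (auto simp: center_scale_def fun_eq_iff distrib_left distrib_right mult.assoc)

text \<open>The spanning set consists of the functions supported at one index of \<open>D\<close>,
  with a value from a finite spanning set \<open>S\<close> of the skew field over its
  center.\<close>

lemma finite_support_span:
  assumes fin: "finite (D :: 'k set)" and fd: "finite_dim_over_center TYPE('a::division_ring)"
  shows "\<exists>C :: ('k \<Rightarrow> 'a::division_ring) set. finite C \<and>
    (\<forall>u. (\<forall>k. k \<notin> D \<longrightarrow> u k = 0) \<longrightarrow> u \<in> module.span center_scale C)"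
proof -
  interpret vector_space "center_scale :: 'a center \<Rightarrow> ('k \<Rightarrow> 'a) \<Rightarrow> _"
    by (rule vector_space_center_scale)
  obtain S :: "'a set" where S: "finite S"
    "\<And>a. \<exists>c. (\<forall>b\<in>S. c b \<in> ring_center) \<and> a = (\<Sum>b\<in>S. c b * b)"
    using fd by (auto simp: finite_dim_over_center_def)
  define \<delta> :: "'k \<Rightarrow> 'a \<Rightarrow> 'k \<Rightarrow> 'a" where "\<delta> k a = (\<lambda>k'. if k' = k then a else 0)" for k a
  define C where "C = (\<lambda>(k, b). \<delta> k b) ` (D \<times> S)"
  have \<delta>: "\<delta> k a \<in> span C" if "k \<in> D" for k a
  proof -
    obtain c where c: "\<forall>b\<in>S. c b \<in> ring_center" "a = (\<Sum>b\<in>S. c b * b)" using S(2)[of a] by blast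
    have "\<delta> k a = (\<Sum>b\<in>S. center_scale (to_center (c b)) (\<delta> k b))"
    proof
      fix k'
      have "(\<Sum>b\<in>S. center_scale (to_center (c b)) (\<delta> k b)) k' =
          (\<Sum>b\<in>S. center_scale (to_center (c b)) (\<delta> k b) k')"
        by (induction S rule: infinite_finite_induct) auto
      also have "\<dots> = \<delta> k a k'"
        using c by (auto simp: \<delta>_def center_scale_def to_center_inverse)
      finally show "\<delta> k a k' = (\<Sum>b\<in>S. center_scale (to_center (c b)) (\<delta> k b)) k'" ..
    qed
    also have "\<dots> \<in> span C"
      using that by (intro span_sum span_scale span_base) (auto simp: C_def)
    finally show ?thesis .
  qed
  have "u \<in> span C" if "\<forall>k. k \<notin> D \<longrightarrow> u k = 0" for u
  proof -
    have "u = (\<Sum>k\<in>D. \<delta> k (u k))"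
    proof
      fix k
      have "(\<Sum>k'\<in>D. \<delta> k' (u k')) k = (\<Sum>k'\<in>D. \<delta> k' (u k') k)"
        by (induction D rule: infinite_finite_induct) auto
      then show "u k = (\<Sum>k\<in>D. \<delta> k (u k)) k"
        using fin that by (auto simp: \<delta>_def)
    qed
    also have "\<dots> \<in> span C" by (intro span_sum \<delta>)
    finally show ?thesis .
  qed
  moreover have "finite C" using fin S(1) by (simp add: C_def)
  ultimately show ?thesis by blast
qed

text \<open>\<open>\<phi>\<close> restricts to the center. If it is the identity there, the fixed
  field is everything and \<open>\<iota> = 0\<close> serves. Otherwise some nonzero
  \<open>\<iota>\<close> changes sign; the symmetric half of \<open>z\<close> is fixed, and so is
  the antisymmetric half divided by \<open>\<iota>\<close>.\<close>

lemma splits_scalars_involution: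
  fixes \<phi> :: "'a::division_ring \<Rightarrow> 'a"
  assumes hom: "ring_hom_fun \<phi>" and inv: "\<And>a. \<phi> (\<phi> a) = a" and char: "(2::'a) \<noteq> 0"
  shows "\<exists>\<iota>. splits_scalars {z. \<phi> (of_center z) = of_center z} \<iota>"
proof -
  let ?K = "{z. \<phi> (of_center z) = of_center z}"
  note h = ring_hom_funD[OF hom]
  have two: "(2 :: 'a center) \<noteq> 0"
  proof
    assume *: "(2 :: 'a center) = 0"
    have "of_center (1 + 1 :: 'a center) = 1 + 1" by (simp only: of_center_add of_center_1)
    then show False
      using char * by (metis one_add_one of_center_0)
  qed
  have inv_hom: "\<phi> (inverse a) = inverse (\<phi> a)" for a
  proof (cases "a = 0")
    case False
    then have "\<phi> (inverse a) * \<phi> a = 1" by (simp flip: h(4) add: h(1))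
    then have "inverse (\<phi> (inverse a)) = \<phi> a" by (rule inverse_unique)
    then show ?thesis by (metis inverse_inverse_eq)
  qed (simp add: h)
  have "\<phi> (of_center z) \<in> ring_center" for z
  proof -
    \<comment> \<open>Writing \<open>a\<close> as \<open>\<phi> (\<phi> a)\<close> reduces this to
      the centrality of \<open>z\<close> inside \<open>\<phi>\<close>.\<close>
    have "\<phi> (of_center z) * a = a * \<phi> (of_center z)" for a
      by (metis h(4) inv of_center_commute)
    then show ?thesis by (simp add: ring_center_def)
  qed
  define \<psi> where "\<psi> z = to_center (\<phi> (of_center z))" for z
  have \<psi>: "of_center (\<psi> z) = \<phi> (of_center z)" for z
    unfolding \<psi>_def by (rule to_center_inverse) fact
  have \<psi>_hom: "\<psi> (x + y) = \<psi> x + \<psi> y" "\<psi> (x - y) = \<psi> x - \<psi> y" "\<psi> (x * y) = \<psi> x * \<psi> y" "\<psi> (\<psi> x) = x"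
    "\<psi> 1 = 1" "\<psi> (inverse x) = inverse (\<psi> x)" "\<psi> x = x \<longleftrightarrow> x \<in> ?K" for x y
    by (simp_all add: of_center_inject[symmetric] \<psi> h inv inv_hom)
  have "\<psi> 2 = 2" using \<psi>_hom(1)[of 1 1] \<psi>_hom(5) by simp
  moreover have \<psi>_div: "\<psi> (x / y) = \<psi> x / \<psi> y" for x y
    unfolding divide_inverse \<psi>_hom(3,6) ..
  ultimately have \<psi>_half: "\<psi> (x / 2) = \<psi> x / 2" for x
    by simp
  have sum: "(z + \<psi> z) / 2 \<in> ?K" for z
    unfolding \<psi>_hom(7)[symmetric] by (simp add: \<psi>_half \<psi>_hom(1,4) add.commute)
  show ?thesis
  proof (cases "\<forall>z. \<psi> z = z")
    case True
    then have "splits_scalars ?K 0"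
      unfolding splits_scalars_def by (simp add: \<psi>_hom(7)[symmetric] del: mem_Collect_eq)
    then show ?thesis ..
  next
    case False
    then obtain w where w: "\<psi> w \<noteq> w" by auto
    define \<iota> where "\<iota> = w - \<psi> w"
    have \<iota>: "\<iota> \<noteq> 0" "\<psi> \<iota> = - \<iota>" using w unfolding \<iota>_def right_minus_eq by (metis, simp add: \<psi>_hom(2,4))
    have "\<exists>a\<in>?K. \<exists>b\<in>?K. z = a + \<iota> * b" for z
    proof (rule bexI[OF _ sum[of z]])
      have d: "(z - \<psi> z) / 2 / \<iota> \<in> ?K"
        unfolding \<psi>_hom(7)[symmetric] \<psi>_div[of _ \<iota>] \<psi>_half \<psi>_hom(2,4) \<iota>(2)
        using \<iota>(1) two by (simp add: field_simps)
      have "(z + \<psi> z) / 2 + \<iota> * ((z - \<psi> z) / 2 / \<iota>) = (z * 2) / 2"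
        unfolding mult_2_right using \<iota>(1) by (simp flip: add_divide_distrib)
      then show "\<exists>b\<in>?K. z = (z + \<psi> z) / 2 + \<iota> * b"
        using two by (intro bexI[OF _ d]) simp
    qed
    moreover have "1 \<in> ?K" by (simp add: h(1))
    ultimately have "splits_scalars ?K \<iota>" unfolding splits_scalars_def by blast
    then show ?thesis ..
  qed
qed

section \<open>Roth's theorem for systems with two twists\<close>

text \<open>\<open>d v\<close> is the full size belonging to \<open>v\<close> and \<open>m v\<close>
  that of its first block. \<open>D_diag\<close> and \<open>T_upper\<close> say that
  \<open>D i\<close> is block diagonal and differs from \<open>T i\<close> at most in the upper
  right block. The flags \<open>\<epsilon>\<close> and \<open>\<delta>\<close> tell whether
  \<open>\<tau>\<close> is applied.\<close>

locale roth_system =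
  fixes V :: "'v set" and m d :: "'v \<Rightarrow> nat" and N :: nat
    and src tgt :: "'i \<Rightarrow> 'v" and \<epsilon> \<delta> :: "'i \<Rightarrow> bool" and I :: "'i set"
    and D T :: "'i \<Rightarrow> nat \<Rightarrow> nat \<Rightarrow> 'a::division_ring"
    and R R' :: "'v \<Rightarrow> nat \<Rightarrow> nat \<Rightarrow> 'a"
    and \<tau> :: "'v \<Rightarrow> 'a \<Rightarrow> 'a"
  assumes finite_V: "finite V"
    and fd: "finite_dim_over_center TYPE('a)"
    and dN: "\<And>v. v \<in> V \<Longrightarrow> d v \<le> N"
    and V: "\<And>i. i \<in> I \<Longrightarrow> src i \<in> V" "\<And>i. i \<in> I \<Longrightarrow> tgt i \<in> V"
    and D: "\<And>i. i \<in> I \<Longrightarrow> supported (d (tgt i)) (d (src i)) (D i)"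
    and T: "\<And>i. i \<in> I \<Longrightarrow> supported (d (tgt i)) (d (src i)) (T i)"
    and D_diag: "\<And>i r c. i \<in> I \<Longrightarrow> D i r c \<noteq> 0 \<Longrightarrow> r < m (tgt i) \<longleftrightarrow> c < m (src i)"
    and T_upper: "\<And>i r c. i \<in> I \<Longrightarrow> m (tgt i) \<le> r \<or> c < m (src i) \<Longrightarrow> T i r c = D i r c"
    and \<tau>: "\<And>v. v \<in> V \<Longrightarrow> ring_hom_fun (\<tau> v)"
    and R: "\<And>v. v \<in> V \<Longrightarrow> supported (d v) (d v) (R v)" "\<And>v. v \<in> V \<Longrightarrow> supported (d v) (d v) (R' v)"
    and RR': "\<And>v. v \<in> V \<Longrightarrow> mult_fun N (R v) (R' v) = unit_fun (d v)"
    and R'R: "\<And>v. v \<in> V \<Longrightarrow> mult_fun N (R' v) (R v) = unit_fun (d v)"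
    and conj: "\<And>i. i \<in> I \<Longrightarrow>
      mult_fun N (D i) (\<lambda>r c. (if \<epsilon> i then \<tau> (src i) else id) (R (src i) r c)) =
      mult_fun N (\<lambda>r c. (if \<delta> i then \<tau> (tgt i) else id) (R (tgt i) r c)) (T i)"
begin

definition tw :: "'v \<Rightarrow> bool \<Rightarrow> (nat \<Rightarrow> nat \<Rightarrow> 'a) \<Rightarrow> nat \<Rightarrow> nat \<Rightarrow> 'a" where
  "tw v b f = (\<lambda>r c. (if b then \<tau> v else id) (f r c))"

definition block :: "('v \<times> bool \<times> nat \<times> nat \<Rightarrow> 'a) \<Rightarrow> 'v \<Rightarrow> bool \<Rightarrow> nat \<Rightarrow> nat \<Rightarrow> 'a" where
  "block u v b = (\<lambda>r c. u (v, b, r, c))"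

text \<open>A family holds two matrices for each \<open>v\<close>; the one with tag \<open>True\<close> stands for the twisted copy,
  which makes the equations linear over the center. \<open>twisted\<close> restores the coupling of the copies.\<close>

definition rep_space :: "('i \<Rightarrow> nat \<Rightarrow> nat \<Rightarrow> 'a) \<Rightarrow> ('v \<times> bool \<times> nat \<times> nat \<Rightarrow> 'a) set" where
  "rep_space E = {u. (\<forall>v b r c. \<not> (v \<in> V \<and> r < d v \<and> c < d v) \<longrightarrow> u (v, b, r, c) = 0) \<and>
     (\<forall>i\<in>I. mult_fun N (D i) (block u (src i) (\<epsilon> i)) = mult_fun N (block u (tgt i) (\<delta> i)) (E i))}"

text \<open>Right multiplication commutes with scalars acting from the left. The factor is twisted
  according to the tag so that coupled copies stay coupled.\<close>

definition th :: "('v \<times> bool \<times> nat \<times> nat \<Rightarrow> 'a) \<Rightarrow> 'v \<times> bool \<times> nat \<times> nat \<Rightarrow> 'a" where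
  "th u = (\<lambda>(v, b, r, c). if v \<in> V then mult_fun N (block u v b) (tw v b (R v)) r c else 0)"

definition th' :: "('v \<times> bool \<times> nat \<times> nat \<Rightarrow> 'a) \<Rightarrow> 'v \<times> bool \<times> nat \<times> nat \<Rightarrow> 'a" where
  "th' u = (\<lambda>(v, b, r, c). if v \<in> V then mult_fun N (block u v b) (tw v b (R' v)) r c else 0)"

definition pr :: "('v \<times> bool \<times> nat \<times> nat \<Rightarrow> 'a) \<Rightarrow> 'v \<times> bool \<times> nat \<times> nat \<Rightarrow> 'a" where
  "pr u = (\<lambda>(v, b, r, c). if c < m v then u (v, b, r, c) else 0)"

definition twisted :: "'v set \<Rightarrow> ('v \<times> bool \<times> nat \<times> nat \<Rightarrow> 'a) set" where
  "twisted A = {u. \<forall>v\<in>A. \<forall>r c. u (v, True, r, c) = \<tau> v (u (v, False, r, c))}"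

lemma hom_if: "v \<in> V \<Longrightarrow> ring_hom_fun (if b then \<tau> v else id)"
  using \<tau> by (auto simp: ring_hom_fun_def)

lemma tw_facts:
  assumes "v \<in> V"
  shows "supported (d v) (d v) (tw v b (R v))" "supported (d v) (d v) (tw v b (R' v))"
    "mult_fun N (tw v b (R v)) (tw v b (R' v)) = unit_fun (d v)"
    "mult_fun N (tw v b (R' v)) (tw v b (R v)) = unit_fun (d v)"
proof -
  note hom = hom_if[OF assms, of b]
  show "supported (d v) (d v) (tw v b (R v))" "supported (d v) (d v) (tw v b (R' v))"
    using R[OF assms] ring_hom_funD(2)[OF hom] by (simp_all add: tw_def supported_def)
  show "mult_fun N (tw v b (R v)) (tw v b (R' v)) = unit_fun (d v)"
    unfolding tw_def map_mult_fun[OF hom, symmetric] RR'[OF assms] by (rule map_unit_fun[OF hom])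
  show "mult_fun N (tw v b (R' v)) (tw v b (R v)) = unit_fun (d v)"
    unfolding tw_def map_mult_fun[OF hom, symmetric] R'R[OF assms] by (rule map_unit_fun[OF hom])
qed

lemma conj': "i \<in> I \<Longrightarrow> mult_fun N (D i) (tw (src i) (\<epsilon> i) (R (src i))) =
    mult_fun N (tw (tgt i) (\<delta> i) (R (tgt i))) (T i)"
  unfolding tw_def by (rule conj)

text \<open>The conjugation identity multiplied by the two inverses; it does for \<open>th'\<close>
  what \<open>conj'\<close> does for \<open>th\<close>.\<close>

lemma conj_inv:
  assumes i: "i \<in> I"
  shows "mult_fun N (tw (tgt i) (\<delta> i) (R' (tgt i))) (D i) = mult_fun N (T i) (tw (src i) (\<epsilon> i) (R' (src i)))"
    (is "mult_fun N ?S' _ = mult_fun N _ ?Q'")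
proof -
  let ?S = "tw (tgt i) (\<delta> i) (R (tgt i))" and ?Q = "tw (src i) (\<epsilon> i) (R (src i))"
  have "mult_fun N ?S' (D i) = mult_fun N ?S' (mult_fun N (D i) (mult_fun N ?Q ?Q'))"
    using mult_fun_unit_right[OF D[OF i]] dN V i by (simp add: tw_facts)
  also have "\<dots> = mult_fun N (mult_fun N ?S' ?S) (mult_fun N (T i) ?Q')"
    using conj'[OF i] by (metis mult_fun_assoc)
  also have "\<dots> = mult_fun N (T i) ?Q'"
    using mult_fun_unit_left[OF T[OF i]] dN V i by (simp add: tw_facts flip: mult_fun_assoc)
  finally show ?thesis .
qed

lemma block_th: "v \<in> V \<Longrightarrow> block (th u) v b = mult_fun N (block u v b) (tw v b (R v))"
  and block_th': "v \<in> V \<Longrightarrow> block (th' u) v b = mult_fun N (block u v b) (tw v b (R' v))"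
  by (simp_all add: block_def th_def th'_def)

lemma rep_space_supported: "u \<in> rep_space E \<Longrightarrow> supported (d v) (d v) (block u v b)"
  by (auto simp: rep_space_def supported_def block_def)

lemma rep_spaceI:
  assumes "\<And>v b r c. v \<notin> V \<Longrightarrow> u (v, b, r, c) = 0"
    and "\<And>v b. v \<in> V \<Longrightarrow> supported (d v) (d v) (block u v b)"
    and "\<And>i. i \<in> I \<Longrightarrow> mult_fun N (D i) (block u (src i) (\<epsilon> i)) = mult_fun N (block u (tgt i) (\<delta> i)) (E i)"
  shows "u \<in> rep_space E"
  using assms unfolding rep_space_def supported_def block_def by blast

lemma rep_spaceD: "u \<in> rep_space E \<Longrightarrow> i \<in> I \<Longrightarrow>
    mult_fun N (D i) (block u (src i) (\<epsilon> i)) = mult_fun N (block u (tgt i) (\<delta> i)) (E i)"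
  by (simp add: rep_space_def)

lemma th_rep_space:
  assumes u: "u \<in> rep_space D"
  shows "th u \<in> rep_space T"
proof (rule rep_spaceI)
  show "supported (d v) (d v) (block (th u) v b)" if "v \<in> V" for v b
    using supported_mult_fun[OF rep_space_supported[OF u] tw_facts(1)[OF that]] that by (simp add: block_th)
  fix i assume i: "i \<in> I"
  let ?s = "block u (src i) (\<epsilon> i)" and ?t = "block u (tgt i) (\<delta> i)"
  let ?S = "tw (tgt i) (\<delta> i) (R (tgt i))" and ?Q = "tw (src i) (\<epsilon> i) (R (src i))"
  have "mult_fun N (D i) (mult_fun N ?s ?Q) = mult_fun N (mult_fun N (D i) ?s) ?Q"
    by (simp add: mult_fun_assoc)
  also have "\<dots> = mult_fun N (mult_fun N ?t (D i)) ?Q"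
    by (simp add: rep_spaceD[OF u i])
  also have "\<dots> = mult_fun N (mult_fun N ?t ?S) (T i)"
    by (simp add: mult_fun_assoc conj'[OF i])
  finally show "mult_fun N (D i) (block (th u) (src i) (\<epsilon> i)) = mult_fun N (block (th u) (tgt i) (\<delta> i)) (T i)"
    using V i by (simp add: block_th)
qed (simp add: th_def)

lemma th'_rep_space:
  assumes u: "u \<in> rep_space T"
  shows "th' u \<in> rep_space D"
proof (rule rep_spaceI)
  show "supported (d v) (d v) (block (th' u) v b)" if "v \<in> V" for v b
    using supported_mult_fun[OF rep_space_supported[OF u] tw_facts(2)[OF that]] that by (simp add: block_th')
  fix i assume i: "i \<in> I"
  let ?s = "block u (src i) (\<epsilon> i)" and ?t = "block u (tgt i) (\<delta> i)"
  let ?S = "tw (tgt i) (\<delta> i) (R' (tgt i))" and ?Q = "tw (src i) (\<epsilon> i) (R' (src i))"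
  have "mult_fun N (D i) (mult_fun N ?s ?Q) = mult_fun N (mult_fun N (D i) ?s) ?Q"
    by (simp add: mult_fun_assoc)
  also have "\<dots> = mult_fun N (mult_fun N ?t (T i)) ?Q"
    by (simp add: rep_spaceD[OF u i])
  also have "\<dots> = mult_fun N (mult_fun N ?t ?S) (D i)"
    by (simp add: mult_fun_assoc conj_inv[OF i])
  finally show "mult_fun N (D i) (block (th' u) (src i) (\<epsilon> i)) = mult_fun N (block (th' u) (tgt i) (\<delta> i)) (D i)"
    using V i by (simp add: block_th')
qed (simp add: th'_def)

lemma block_eqI:
  assumes "u \<in> rep_space E" "w \<in> rep_space E'" "\<And>v b. v \<in> V \<Longrightarrow> block u v b = block w v b"
  shows "u = w"
proof
  fix k :: "'v \<times> bool \<times> nat \<times> nat"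
  obtain v b r c where k: "k = (v, b, r, c)" by (cases k)
  show "u k = w k"
  proof (cases "v \<in> V")
    case True
    from fun_cong[OF fun_cong[OF assms(3)[OF this, of b]], of r c] show ?thesis
      by (simp add: block_def k)
  qed (use assms(1,2) in \<open>auto simp: rep_space_def k\<close>)
qed

lemma th_th':
  assumes u: "u \<in> rep_space T"
  shows "th (th' u) = u"
  by (rule block_eqI[OF th_rep_space[OF th'_rep_space[OF u]] u])
    (simp add: block_th block_th' mult_fun_assoc tw_facts
      mult_fun_unit_right[OF rep_space_supported[OF u] dN])

lemma th'_th:
  assumes u: "u \<in> rep_space D"
  shows "th' (th u) = u"
  by (rule block_eqI[OF th'_rep_space[OF th_rep_space[OF u]] u])
    (simp add: block_th block_th' mult_fun_assoc tw_facts
      mult_fun_unit_right[OF rep_space_supported[OF u] dN])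

text \<open>\<open>\<tau> v\<close> is multiplicative, so twisting both factors twists the
  product.\<close>

lemma twisted_th:
  assumes A: "A \<subseteq> V" and u: "u \<in> twisted A"
  shows "th u \<in> twisted A" "th' u \<in> twisted A"
proof -
  have *: "mult_fun N (block u v True) (tw v True f) r c = \<tau> v (mult_fun N (block u v False) (tw v False f) r c)"
    if "v \<in> A" for v f r c
  proof -
    have "\<tau> v (mult_fun N (block u v False) (tw v False f) r c) =
        mult_fun N (\<lambda>r c. \<tau> v (block u v False r c)) (\<lambda>r c. \<tau> v (tw v False f r c)) r c"
      using map_mult_fun[OF \<tau>, of v N] that A by (metis subsetD)
    then show ?thesis using u that by (simp add: twisted_def block_def tw_def)
  qed
  show "th u \<in> twisted A" "th' u \<in> twisted A"
    using A * unfolding twisted_def by (auto simp: th_def th'_def)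
qed

lemma block_pr: "block (pr u) v b = (\<lambda>r c. if c < m v then block u v b r c else 0)"
  by (auto simp: fun_eq_iff block_def pr_def)

lemma upper_column:
  assumes "i \<in> I" "c < m (src i)"
  shows "mult_fun N f (T i) r c = mult_fun N f (D i) r c"
  using T_upper[OF assms(1)] assms(2) by (simp add: mult_fun_def)

text \<open>\<open>T\<close> agrees with \<open>D\<close> in the first block column, and there the
  block diagonal \<open>D\<close> meets only the first block column of the family. So truncation
  turns an equation of either kind into one for \<open>D\<close>.\<close>

lemma pr_rep_space:
  assumes u: "u \<in> rep_space D \<or> u \<in> rep_space T"
  shows "pr u \<in> rep_space D"
proof (rule rep_spaceI)
  have supp: "supported (d v) (d v) (block u v b)" for v b
    using u rep_space_supported by blast
  show "supported (d v) (d v) (block (pr u) v b)" for v b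
    using supp[of v b] by (simp add: block_pr supported_def)
  show "pr u (v, b, r, c) = 0" if "v \<notin> V" for v b r c
    using u that by (auto simp: pr_def rep_space_def)
  fix i assume i: "i \<in> I"
  let ?s = "block u (src i) (\<epsilon> i)" and ?t = "block u (tgt i) (\<delta> i)"
  show "mult_fun N (D i) (block (pr u) (src i) (\<epsilon> i)) = mult_fun N (block (pr u) (tgt i) (\<delta> i)) (D i)"
  proof (intro ext)
    fix r c
    show "mult_fun N (D i) (block (pr u) (src i) (\<epsilon> i)) r c =
      mult_fun N (block (pr u) (tgt i) (\<delta> i)) (D i) r c"
    proof (cases "c < m (src i)")
      case True
      have "mult_fun N (D i) (block (pr u) (src i) (\<epsilon> i)) r c = mult_fun N (D i) ?s r c"
        using True by (simp add: block_pr mult_fun_def)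
      also have "\<dots> = mult_fun N ?t (D i) r c"
        using u rep_spaceD[OF _ i] upper_column[OF i True] by metis
      also have "\<dots> = mult_fun N (block (pr u) (tgt i) (\<delta> i)) (D i) r c"
        unfolding block_pr mult_fun_def using D_diag[OF i, of _ c] True by (intro sum.cong) auto
      finally show ?thesis .
    next
      case False
      then have "mult_fun N (block (pr u) (tgt i) (\<delta> i)) (D i) r c = 0"
        unfolding block_pr mult_fun_def using D_diag[OF i, of _ c] by (intro sum.neutral) auto
      then show ?thesis using False by (simp add: block_pr mult_fun_def)
    qed
  qed
qed

text \<open>With the first block column of \<open>u\<close> zero, only the lower block row of
  \<open>T\<close> enters the product, and it equals that of \<open>D\<close>.\<close>

lemma pr_kernel:
  assumes "pr u = 0"
  shows "u \<in> rep_space T \<longleftrightarrow> u \<in> rep_space D"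
proof -
  have "block u v b r c = 0" if "c < m v" for v b r c
    using fun_cong[OF assms, of "(v, b, r, c)"] that by (simp add: block_def pr_def)
  then have "mult_fun N (block u (tgt i) b) (T i) = mult_fun N (block u (tgt i) b) (D i)" if "i \<in> I" for i b
    unfolding mult_fun_def using T_upper[OF that] by (intro ext sum.cong refl) (metis mult_zero_left not_less)
  then show ?thesis by (simp add: rep_space_def)
qed

lemma pr_twisted: "A \<subseteq> V \<Longrightarrow> u \<in> twisted A \<Longrightarrow> pr u \<in> twisted A"
  using ring_hom_funD(2)[OF \<tau>] by (auto simp: twisted_def pr_def)

lemma rep_space_closed:
  shows "0 \<in> rep_space D" "u \<in> rep_space D \<Longrightarrow> w \<in> rep_space D \<Longrightarrow> u + w \<in> rep_space D"
    "u \<in> rep_space D \<Longrightarrow> w \<in> rep_space D \<Longrightarrow> u - w \<in> rep_space D"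
    "u \<in> rep_space D \<Longrightarrow> center_scale z u \<in> rep_space D"
proof -
  have comm: "of_center z * a = a * of_center z" for a :: 'a and z by (rule of_center_commute)
  have lin: "mult_fun N f (block (u + w) v b) = (\<lambda>r c. mult_fun N f (block u v b) r c + mult_fun N f (block w v b) r c)"
    "mult_fun N (block (u + w) v b) f = (\<lambda>r c. mult_fun N (block u v b) f r c + mult_fun N (block w v b) f r c)"
    "mult_fun N f (block (u - w) v b) = (\<lambda>r c. mult_fun N f (block u v b) r c - mult_fun N f (block w v b) r c)"
    "mult_fun N (block (u - w) v b) f = (\<lambda>r c. mult_fun N (block u v b) f r c - mult_fun N (block w v b) f r c)"
    "mult_fun N (block (center_scale z u) v b) f = (\<lambda>r c. of_center z * mult_fun N (block u v b) f r c)"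
    for u w f v b z
    unfolding mult_fun_def block_def center_scale_def
    by (simp_all add: fun_eq_iff distrib_left distrib_right left_diff_distrib right_diff_distrib
        sum.distrib sum_subtractf sum_distrib_left mult.assoc)
  \<comment> \<open>Here the scalar stands to the right of \<open>f\<close>, and moving it out uses
    that it is central.\<close>
  have scale: "mult_fun N f (block (center_scale z u) v b) = (\<lambda>r c. of_center z * mult_fun N f (block u v b) r c)"
    for f u v b z
    unfolding mult_fun_def block_def center_scale_def sum_distrib_left
    by (intro ext sum.cong refl) (metis comm mult.assoc)
  show "0 \<in> rep_space D" by (simp add: rep_space_def mult_fun_def block_def)
  show "u \<in> rep_space D \<Longrightarrow> w \<in> rep_space D \<Longrightarrow> u + w \<in> rep_space D"
    "u \<in> rep_space D \<Longrightarrow> w \<in> rep_space D \<Longrightarrow> u - w \<in> rep_space D"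
    "u \<in> rep_space D \<Longrightarrow> center_scale z u \<in> rep_space D"
    unfolding rep_space_def by (simp_all add: lin scale) (simp add: center_scale_def)
qed

lemma rep_space_finite_span:
  "\<exists>C :: ('v \<times> bool \<times> nat \<times> nat \<Rightarrow> 'a) set. finite C \<and> rep_space D \<subseteq> module.span center_scale C"
proof -
  let ?supp = "V \<times> (UNIV :: bool set) \<times> {..<N} \<times> {..<N}"
  have "finite ?supp" using finite_V by simp
  from finite_support_span[OF this fd]
  obtain C :: "('v \<times> bool \<times> nat \<times> nat \<Rightarrow> 'a) set" where C: "finite C"
    "\<And>u. (\<forall>k. k \<notin> ?supp \<longrightarrow> u k = 0) \<Longrightarrow> u \<in> module.span center_scale C" by auto
  have "u \<in> module.span center_scale C" if "u \<in> rep_space D" for u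
  proof (rule C(2), intro allI impI)
    fix k assume k: "k \<notin> ?supp"
    obtain v b r c where vbrc: "k = (v, b, r, c)" by (cases k)
    then have "\<not> (v \<in> V \<and> r < d v \<and> c < d v)" using k dN[of v] by auto
    then show "u k = 0" using that vbrc by (simp add: rep_space_def)
  qed
  then show ?thesis using C(1) by blast
qed

section \<open>Applying the theorem on linked subgroups to the families\<close>

lemma linked_subgroups_rep_space:
  assumes "finite C" "rep_space D \<subseteq> module.span center_scale C"
  shows "linked_subgroups center_scale pr th (rep_space D) C"
proof (intro linked_subgroups.intro linked_subgroups_axioms.intro)
  show vs: "vector_space (center_scale :: 'a center \<Rightarrow> ('v \<times> bool \<times> nat \<times> nat \<Rightarrow> 'a) \<Rightarrow> _)"
    by (rule vector_space_center_scale)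
  show "Vector_Spaces.linear center_scale center_scale pr"
    unfolding Vector_Spaces.linear_iff using vector_space_center_scale
    by (auto simp: pr_def center_scale_def fun_eq_iff)
  show "Vector_Spaces.linear center_scale center_scale th"
    unfolding Vector_Spaces.linear_iff using vector_space_center_scale
    by (auto simp: th_def center_scale_def fun_eq_iff mult_fun_def block_def distrib_right
        sum.distrib sum_distrib_left mult.assoc)
  show "pr (pr v) = pr v" for v by (auto simp: pr_def fun_eq_iff)
  show "inj_on th (rep_space D)" by (rule inj_on_inverseI[of _ th']) (rule th'_th)
  show "module.subspace center_scale (rep_space D)"
    unfolding module.subspace_def[OF vs[folded module_iff_vector_space]]
    by (simp add: rep_space_closed)
qed (fact assms)+

text \<open>The two twists act on the index sets \<open>A\<close> and \<open>B\<close>, and each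
  yields a linked pair closed under its own fixed field. The identity family lies in both groups on
  the \<open>D\<close> side, so some family in both groups on the \<open>T\<close> side has the same
  first block column.\<close>

lemma solution:
  assumes A: "A \<union> B = V"
    and \<tau>A: "\<And>v. v \<in> A \<Longrightarrow> \<tau> v = \<phi>" and \<tau>B: "\<And>v. v \<in> B \<Longrightarrow> \<tau> v = \<psi>"
    and \<phi>: "ring_hom_fun \<phi>" "\<exists>\<iota>. splits_scalars {z. \<phi> (of_center z) = of_center z} \<iota>"
    and \<psi>: "ring_hom_fun \<psi>" "\<exists>\<iota>. splits_scalars {z. \<psi> (of_center z) = of_center z} \<iota>"
  obtains S where "\<And>v. supported (d v) (d v) (S v)"
    "\<And>v r c. v \<in> V \<Longrightarrow> c < m v \<Longrightarrow> S v r c = unit_fun (d v) r c"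
    "\<And>i. i \<in> I \<Longrightarrow> mult_fun N (D i) (tw (src i) (\<epsilon> i) (S (src i))) =
      mult_fun N (tw (tgt i) (\<delta> i) (S (tgt i))) (T i)"
proof -
  from \<phi>(2) obtain \<iota>1 where split1: "splits_scalars {z. \<phi> (of_center z) = of_center z} \<iota>1" ..
  from \<psi>(2) obtain \<iota>2 where split2: "splits_scalars {z. \<psi> (of_center z) = of_center z} \<iota>2" ..
  obtain C :: "('v \<times> bool \<times> nat \<times> nat \<Rightarrow> 'a) set" where C: "finite C"
    "rep_space D \<subseteq> module.span center_scale C"
    using rep_space_finite_span by blast
  interpret linked_subgroups center_scale pr th "rep_space D" C
    by (rule linked_subgroups_rep_space[OF C])
  have linked: "linked (rep_space D \<inter> twisted A) (rep_space T \<inter> twisted A)" if "A \<subseteq> V" for A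
    unfolding linked_def
  proof (intro conjI allI impI)
    show "rep_space T \<inter> twisted A = th ` (rep_space D \<inter> twisted A)"
    proof (intro equalityI subsetI)
      fix u assume u: "u \<in> rep_space T \<inter> twisted A"
      then have "th' u \<in> rep_space D \<inter> twisted A" "u = th (th' u)"
        using th'_rep_space twisted_th[OF that] th_th' by auto
      then show "u \<in> th ` (rep_space D \<inter> twisted A)" by blast
    qed (use th_rep_space twisted_th[OF that] in auto)
    show "pr ` (rep_space D \<inter> twisted A) \<subseteq> rep_space D \<inter> twisted A"
      "pr ` (rep_space T \<inter> twisted A) \<subseteq> rep_space D \<inter> twisted A"
      using pr_rep_space pr_twisted[OF that] by auto
  qed (use pr_kernel in auto)
  have closed: "closed_under {z. \<phi> (of_center z) = of_center z} (rep_space D \<inter> twisted A)"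
    if "\<And>v. v \<in> A \<Longrightarrow> \<tau> v = \<phi>" "ring_hom_fun \<phi>" for A \<phi>
    unfolding closed_under_def
    using rep_space_closed that(1) ring_hom_funD[OF that(2)]
    by (auto simp: twisted_def center_scale_def)
  \<comment> \<open>The family of identity matrices satisfies the equations for \<open>D\<close> and
    is fixed by every twist.\<close>
  let ?u = "\<lambda>(v, b, r, c). if v \<in> V then unit_fun (d v) r c else 0 :: 'a"
  have block_u: "block ?u v b = unit_fun (d v)" if "v \<in> V" for v b
    using that by (simp add: block_def)
  have "?u \<in> rep_space D"
  proof (rule rep_spaceI)
    fix i assume i: "i \<in> I"
    show "mult_fun N (D i) (block ?u (src i) (\<epsilon> i)) = mult_fun N (block ?u (tgt i) (\<delta> i)) (D i)"
      using mult_fun_unit_right[OF D[OF i]] mult_fun_unit_left[OF D[OF i]] V[OF i] dN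
      by (simp add: block_u)
  qed (auto simp: block_u supported_def unit_fun_def)
  moreover have "?u \<in> twisted V"
    using ring_hom_funD(1,2)[OF \<tau>] by (auto simp: twisted_def unit_fun_def)
  ultimately have "?u \<in> (rep_space D \<inter> twisted A) \<inter> (rep_space D \<inter> twisted B)"
    using A by (auto simp: twisted_def)
  moreover have "pr ` ((rep_space D \<inter> twisted A) \<inter> (rep_space D \<inter> twisted B)) \<subseteq>
      pr ` ((rep_space T \<inter> twisted A) \<inter> (rep_space T \<inter> twisted B))"
    using A by (intro pr_image_Int[OF split1 split2] linked closed \<tau>A \<tau>B \<phi> \<psi>) auto
  ultimately obtain w where w: "w \<in> rep_space T" "w \<in> twisted A" "w \<in> twisted B" "pr w = pr ?u"
    by (auto simp: image_def)
  \<comment> \<open>Membership in \<open>twisted A\<close> and \<open>twisted B\<close> recovers the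
    copy with tag \<open>True\<close> from the other one for every \<open>v\<close>, so a single
    matrix per \<open>v\<close> remains.\<close>
  have blk: "block w v b = tw v b (block w v False)" if "v \<in> V" for v b
    using w(2,3) that A by (auto simp: tw_def block_def twisted_def fun_eq_iff)
  show thesis
  proof (rule that[of "\<lambda>v. block w v False"])
    show "block w v False r c = unit_fun (d v) r c" if "v \<in> V" "c < m v" for v r c
      using fun_cong[OF w(4), of "(v, False, r, c)"] that by (simp add: pr_def block_def)
    show "mult_fun N (D i) (tw (src i) (\<epsilon> i) (block w (src i) False)) =
        mult_fun N (tw (tgt i) (\<delta> i) (block w (tgt i) False)) (T i)" if "i \<in> I" for i
      using rep_spaceD[OF w(1) that] blk V[OF that] by metis
  qed (rule rep_space_supported[OF w(1)])
qed

end

section \<open>From padded functions back to matrices\<close>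

definition to_fun :: "'a::ring_1 mat \<Rightarrow> nat \<Rightarrow> nat \<Rightarrow> 'a" where
  "to_fun A r c = (if r < dim_row A \<and> c < dim_col A then A $$ (r, c) else 0)"

lemma supported_to_fun: "A \<in> carrier_mat a b \<Longrightarrow> supported a b (to_fun A)"
  by (auto simp: supported_def to_fun_def)

lemma to_fun_one: "to_fun (1\<^sub>m d) = unit_fun d"
  by (auto simp: fun_eq_iff to_fun_def unit_fun_def)

lemma to_fun_mult:
  assumes A: "A \<in> carrier_mat a b" and B: "B \<in> carrier_mat b c" and "b \<le> N"
  shows "to_fun (A * B) = mult_fun N (to_fun A) (to_fun B)"
proof (intro ext)
  fix i j
  show "to_fun (A * B) i j = mult_fun N (to_fun A) (to_fun B) i j"
  proof (cases "i < a \<and> j < c")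
    case True
    have "mult_fun N (to_fun A) (to_fun B) i j = (\<Sum>k\<in>{0..<b}. to_fun A i k * to_fun B k j)"
      unfolding mult_fun_def using assms by (intro sum.mono_neutral_right) (auto simp: to_fun_def)
    also have "\<dots> = (A * B) $$ (i, j)"
      using True A B by (auto simp: scalar_prod_def to_fun_def intro!: sum.cong)
    finally show ?thesis using True A B by (simp add: to_fun_def)
  next
    case False
    then have "mult_fun N (to_fun A) (to_fun B) i j = 0"
      unfolding mult_fun_def using A B by (intro sum.neutral) (auto simp: to_fun_def)
    then show ?thesis using False A B by (auto simp: to_fun_def)
  qed
qed

lemma to_fun_map: "f 0 = 0 \<Longrightarrow> to_fun (map_mat f A) = (\<lambda>r c. f (to_fun A r c))"
  by (auto simp: fun_eq_iff to_fun_def)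

definition twist_mat :: "('a \<Rightarrow> 'a) \<Rightarrow> bool \<Rightarrow> 'a mat \<Rightarrow> 'a mat" where
  "twist_mat f b X = (if b then map_mat f X else X)"

lemma twist_mat_carrier [simp]: "twist_mat f b X \<in> carrier_mat r c \<longleftrightarrow> X \<in> carrier_mat r c"
  by (simp add: twist_mat_def)

lemma to_fun_twist: "f 0 = 0 \<Longrightarrow> to_fun (twist_mat f b X) = (\<lambda>r c. (if b then f else id) (to_fun X r c))"
  by (auto simp: twist_mat_def to_fun_map)

lemma sum_split_at:
  fixes g :: "nat \<Rightarrow> 'a::comm_monoid_add"
  assumes "a + b \<le> N" "\<And>k. a + b \<le> k \<Longrightarrow> g k = 0"
  shows "sum g {..<N} = sum g {..<a} + (\<Sum>l<b. g (a + l))"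
proof -
  have "sum g {..<N} = sum g {..<a + b}"
    using assms by (intro sum.mono_neutral_right) auto
  also have "\<dots> = sum g {..<a} + (\<Sum>l<b. g (a + l))"
    by (induction b) (simp_all add: add.assoc)
  finally show ?thesis .
qed

text \<open>The family \<open>S\<close> from \<open>solution\<close> satisfies
  \<open>D S = S T\<close> up to twists and has the first block column of the identity. Comparing
  upper right blocks gives the equation for the upper right block of \<open>S\<close>, which is
  taken as \<open>X\<close>.\<close>

theorem twisted_roth:
  fixes \<tau> :: "'v \<Rightarrow> 'a::division_ring \<Rightarrow> 'a" and A B C :: "'i \<Rightarrow> 'a mat" and P P' :: "'v \<Rightarrow> 'a mat"
  assumes fd: "finite_dim_over_center TYPE('a)" and char: "(2::'a) \<noteq> 0"
    and Vab: "finite V" "Va \<union> Vb = V"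
    and \<tau>a: "\<And>v. v \<in> Va \<Longrightarrow> \<tau> v = \<phi>" and \<tau>b: "\<And>v. v \<in> Vb \<Longrightarrow> \<tau> v = \<psi>"
    and \<phi>: "ring_hom_fun \<phi>" "\<And>a. \<phi> (\<phi> a) = a" and \<psi>: "ring_hom_fun \<psi>" "\<And>a. \<psi> (\<psi> a) = a"
    and st: "\<And>i. i \<in> I \<Longrightarrow> src i \<in> V" "\<And>i. i \<in> I \<Longrightarrow> tgt i \<in> V"
    and A: "\<And>i. i \<in> I \<Longrightarrow> A i \<in> carrier_mat (m (tgt i)) (m (src i))"
    and B: "\<And>i. i \<in> I \<Longrightarrow> B i \<in> carrier_mat (n (tgt i)) (n (src i))"
    and C: "\<And>i. i \<in> I \<Longrightarrow> C i \<in> carrier_mat (m (tgt i)) (n (src i))"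
    and P: "\<And>v. v \<in> V \<Longrightarrow> P v \<in> carrier_mat (m v + n v) (m v + n v)"
      "\<And>v. v \<in> V \<Longrightarrow> P' v \<in> carrier_mat (m v + n v) (m v + n v)"
      "\<And>v. v \<in> V \<Longrightarrow> P v * P' v = 1\<^sub>m (m v + n v)" "\<And>v. v \<in> V \<Longrightarrow> P' v * P v = 1\<^sub>m (m v + n v)"
    and eq: "\<And>i. i \<in> I \<Longrightarrow>
      four_block_mat (A i) (0\<^sub>m (m (tgt i)) (n (src i))) (0\<^sub>m (n (tgt i)) (m (src i))) (B i) *
        twist_mat (\<tau> (src i)) (\<epsilon> i) (P (src i)) =
      twist_mat (\<tau> (tgt i)) (\<delta> i) (P (tgt i)) *
        four_block_mat (A i) (C i) (0\<^sub>m (n (tgt i)) (m (src i))) (B i)"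
  shows "\<exists>X. (\<forall>v\<in>V. X v \<in> carrier_mat (m v) (n v)) \<and>
    (\<forall>i\<in>I. A i * twist_mat (\<tau> (src i)) (\<epsilon> i) (X (src i)) -
      twist_mat (\<tau> (tgt i)) (\<delta> i) (X (tgt i)) * B i = C i)"
proof -
  define d where "d v = m v + n v" for v
  define N where "N = (\<Sum>v\<in>V. d v)"
  define D where "D i = four_block_mat (A i) (0\<^sub>m (m (tgt i)) (n (src i))) (0\<^sub>m (n (tgt i)) (m (src i))) (B i)" for i
  define T where "T i = four_block_mat (A i) (C i) (0\<^sub>m (n (tgt i)) (m (src i))) (B i)" for i
  have dN: "d v \<le> N" if "v \<in> V" for v
    unfolding N_def using Vab that by (intro member_le_sum) auto
  have Dcar: "D i \<in> carrier_mat (d (tgt i)) (d (src i))" if "i \<in> I" for i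
    unfolding D_def d_def by (rule four_block_carrier_mat[OF A[OF that] B[OF that]])
  have Tcar: "T i \<in> carrier_mat (d (tgt i)) (d (src i))" if "i \<in> I" for i
    unfolding T_def d_def by (rule four_block_carrier_mat[OF A[OF that] B[OF that]])
  have hom: "ring_hom_fun (\<tau> v)" if "v \<in> V" for v
    using that Vab(2) \<tau>a \<tau>b \<phi>(1) \<psi>(1) by auto
  note hom0 = ring_hom_funD(2)[OF hom]
  interpret roth_system V m d N src tgt \<epsilon> \<delta> I "\<lambda>i. to_fun (D i)" "\<lambda>i. to_fun (T i)"
    "\<lambda>v. to_fun (P v)" "\<lambda>v. to_fun (P' v)" \<tau>
  proof
    show "to_fun (D i) r c \<noteq> 0 \<Longrightarrow> (r < m (tgt i)) = (c < m (src i))" if "i \<in> I" for i r c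
      using A[OF that] B[OF that] by (auto simp: D_def to_fun_def split: if_splits)
    show "m (tgt i) \<le> r \<or> c < m (src i) \<Longrightarrow> to_fun (T i) r c = to_fun (D i) r c" if "i \<in> I" for i r c
      using A[OF that] B[OF that] C[OF that] by (auto simp: D_def T_def to_fun_def)
    show "mult_fun N (to_fun (D i)) (\<lambda>r c. (if \<epsilon> i then \<tau> (src i) else id) (to_fun (P (src i)) r c)) =
        mult_fun N (\<lambda>r c. (if \<delta> i then \<tau> (tgt i) else id) (to_fun (P (tgt i)) r c)) (to_fun (T i))"
      if i: "i \<in> I" for i
    proof -
      have "to_fun (D i * twist_mat (\<tau> (src i)) (\<epsilon> i) (P (src i))) =
          to_fun (twist_mat (\<tau> (tgt i)) (\<delta> i) (P (tgt i)) * T i)"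
        using eq[OF i] by (simp add: D_def T_def)
      then show ?thesis
        using to_fun_mult[OF Dcar[OF i], of "twist_mat (\<tau> (src i)) (\<epsilon> i) (P (src i))" "d (src i)" N]
          to_fun_mult[OF _ Tcar[OF i], of "twist_mat (\<tau> (tgt i)) (\<delta> i) (P (tgt i))" "d (tgt i)" N]
          P(1)[OF st(1)[OF i]] P(1)[OF st(2)[OF i]] dN[OF st(1)[OF i]] dN[OF st(2)[OF i]]
        by (simp add: to_fun_twist hom0[OF st(1)[OF i]] hom0[OF st(2)[OF i]] flip: d_def)
    qed
    show "mult_fun N (to_fun (P v)) (to_fun (P' v)) = unit_fun (d v)"
      "mult_fun N (to_fun (P' v)) (to_fun (P v)) = unit_fun (d v)" if "v \<in> V" for v
      using to_fun_mult[OF P(1)[OF that] P(2)[OF that], of N]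
        to_fun_mult[OF P(2)[OF that] P(1)[OF that], of N] P(3,4)[OF that] dN[OF that]
      by (simp_all add: to_fun_one d_def)
    show "supported (d (tgt i)) (d (src i)) (to_fun (D i))" "supported (d (tgt i)) (d (src i)) (to_fun (T i))"
      if "i \<in> I" for i
      using Dcar[OF that] Tcar[OF that] by (simp_all add: supported_to_fun)
    show "supported (d v) (d v) (to_fun (P v))" "supported (d v) (d v) (to_fun (P' v))" if "v \<in> V" for v
      using P(1,2)[OF that] by (simp_all add: supported_to_fun d_def)
  qed (fact Vab(1) fd dN st hom)+
  from solution[OF Vab(2) \<tau>a \<tau>b \<phi>(1) splits_scalars_involution[OF \<phi> char] \<psi>(1)
      splits_scalars_involution[OF \<psi> char]]
  obtain S where S: "\<And>v. supported (d v) (d v) (S v)"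
    "\<And>v r c. v \<in> V \<Longrightarrow> c < m v \<Longrightarrow> S v r c = unit_fun (d v) r c"
    "\<And>i. i \<in> I \<Longrightarrow> mult_fun N (to_fun (D i)) (tw (src i) (\<epsilon> i) (S (src i))) =
      mult_fun N (tw (tgt i) (\<delta> i) (S (tgt i))) (to_fun (T i))"
    by blast
  define X where "X v = mat (m v) (n v) (\<lambda>(r, c). S v r (m v + c))" for v
  have X: "X v \<in> carrier_mat (m v) (n v)" for v by (simp add: X_def)
  have "A i * twist_mat (\<tau> (src i)) (\<epsilon> i) (X (src i)) -
      twist_mat (\<tau> (tgt i)) (\<delta> i) (X (tgt i)) * B i = C i" (is "A i * ?Xs - ?Xt * B i = C i")
    if i: "i \<in> I" for i
  proof (rule eq_matI)
    let ?s = "src i" and ?t = "tgt i"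
    let ?f = "if \<epsilon> i then \<tau> ?s else id" and ?g = "if \<delta> i then \<tau> ?t else id"
    note car = A[OF i] B[OF i] C[OF i]
    have g: "?g 0 = 0" "?g 1 = 1"
      using hom0[OF st(2)[OF i]] ring_hom_funD(1)[OF hom[OF st(2)[OF i]]] by auto
    fix r c assume "r < dim_row (C i)" "c < dim_col (C i)"
    then have rc: "r < m ?t" "c < n ?s" using car by auto
    \<comment> \<open>Column \<open>m ?s + c\<close> is column \<open>c\<close> of the second block
      column. The sum is split at the block boundary, and its second part vanishes because the upper
      right block of \<open>D i\<close> is zero.\<close>
    have "mult_fun N (to_fun (D i)) (tw ?s (\<epsilon> i) (S ?s)) r (m ?s + c) =
        (\<Sum>k<m ?s. to_fun (D i) r k * ?f (S ?s k (m ?s + c))) +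
        (\<Sum>l<n ?s. to_fun (D i) r (m ?s + l) * ?f (S ?s (m ?s + l) (m ?s + c)))"
      unfolding mult_fun_def tw_def using dN[OF st(1)[OF i]] Dcar[OF i]
      by (intro sum_split_at) (auto simp: d_def to_fun_def)
    also have "\<dots> = (\<Sum>k<m ?s. A i $$ (r, k) * ?Xs $$ (k, c)) + 0"
      using rc car by (intro arg_cong2[of _ _ _ _ "(+)"] sum.cong sum.neutral)
        (auto simp: D_def to_fun_def twist_mat_def X_def)
    also have "\<dots> = (A i * ?Xs) $$ (r, c)"
      using rc car X[of ?s] by (simp add: scalar_prod_def twist_mat_def lessThan_atLeast0)
    finally have L: "mult_fun N (to_fun (D i)) (tw ?s (\<epsilon> i) (S ?s)) r (m ?s + c) = (A i * ?Xs) $$ (r, c)" .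
    have "mult_fun N (tw ?t (\<delta> i) (S ?t)) (to_fun (T i)) r (m ?s + c) =
        (\<Sum>k<m ?t. ?g (S ?t r k) * to_fun (T i) k (m ?s + c)) +
        (\<Sum>l<n ?t. ?g (S ?t r (m ?t + l)) * to_fun (T i) (m ?t + l) (m ?s + c))"
      unfolding mult_fun_def tw_def using dN[OF st(2)[OF i]] Tcar[OF i]
      by (intro sum_split_at) (auto simp: d_def to_fun_def)
    \<comment> \<open>The twist fixes 0 and 1, so the first \<open>m ?t\<close> entries of row
      \<open>r\<close> are those of the identity and select the entry of \<open>C i\<close>.\<close>
    also have "(\<Sum>k<m ?t. ?g (S ?t r k) * to_fun (T i) k (m ?s + c)) =
        (\<Sum>k<m ?t. if k = r then C i $$ (r, c) else 0)"
      using rc car by (intro sum.cong) (auto simp: S(2)[OF st(2)[OF i]] unit_fun_def g T_def to_fun_def d_def)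
    also have "\<dots> = C i $$ (r, c)" using rc by simp
    also have "(\<Sum>l<n ?t. ?g (S ?t r (m ?t + l)) * to_fun (T i) (m ?t + l) (m ?s + c)) =
        (\<Sum>l<n ?t. ?Xt $$ (r, l) * B i $$ (l, c))"
      using rc car by (intro sum.cong) (auto simp: T_def to_fun_def twist_mat_def X_def)
    also have "\<dots> = (?Xt * B i) $$ (r, c)"
      using rc car X[of ?t] by (simp add: scalar_prod_def twist_mat_def lessThan_atLeast0)
    finally have R: "mult_fun N (tw ?t (\<delta> i) (S ?t)) (to_fun (T i)) r (m ?s + c) =
        C i $$ (r, c) + (?Xt * B i) $$ (r, c)" .
    have "(A i * ?Xs) $$ (r, c) = C i $$ (r, c) + (?Xt * B i) $$ (r, c)"
      using L R S(3)[OF i] by simp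
    then show "(A i * ?Xs - ?Xt * B i) $$ (r, c) = C i $$ (r, c)"
      using rc car X[of ?s] X[of ?t] by simp
  qed (use A[OF i] B[OF i] C[OF i] X in \<open>auto simp: twist_mat_def\<close>)
  with X show ?thesis by blast
qed

section \<open>The anti-automorphism and the doubled system\<close>

lemma map_mat_mult:
  assumes f: "ring_hom_fun f" and A: "A \<in> carrier_mat a b" and B: "B \<in> carrier_mat b c"
  shows "map_mat f (A * B) = map_mat f A * map_mat f B"
  using A B by (intro eq_matI) (auto simp: scalar_prod_def ring_hom_funD[OF f] intro!: sum.cong)

lemma map_mat_ring_hom:
  assumes f: "ring_hom_fun f"
  shows "map_mat f (1\<^sub>m n) = 1\<^sub>m n" "map_mat f (0\<^sub>m r c) = 0\<^sub>m r c" "map_mat f (- A) = - map_mat f A"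
  by (auto intro!: eq_matI simp: ring_hom_funD[OF f])

lemma mat_inv_eq:
  assumes A: "A \<in> carrier_mat n n" and B: "B \<in> carrier_mat n n" and AB: "A * B = 1\<^sub>m n" "B * A = 1\<^sub>m n"
  shows "mat_inv A = B"
  unfolding mat_inv_def
proof (rule the_equality)
  show "inverts_mat A B \<and> inverts_mat B A" using assms by (simp add: inverts_mat_def)
  fix B' assume B': "inverts_mat A B' \<and> inverts_mat B' A"
  then have eq: "A * B' = 1\<^sub>m n" "B' * A = 1\<^sub>m (dim_row B')"
    using A by (simp_all add: inverts_mat_def)
  \<comment> \<open>\<open>inverts_mat\<close> does not prescribe the size of \<open>B'\<close>; it
    is read off from the sizes of the two products.\<close>
  have dims: "dim_col B' = n" "dim_row B' = n"
    using arg_cong[OF eq(1), of dim_col] arg_cong[OF eq(2), of dim_col] A by auto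
  then have B'c: "B' \<in> carrier_mat n n" by auto
  have "B' = (B * A) * B'" using AB B'c by simp
  also have "\<dots> = B * (A * B')" by (rule assoc_mult_mat[OF B A B'c])
  also have "\<dots> = B" using eq(1) B by simp
  finally show "B' = B" .
qed

lemma uminus_zero_mat [simp]: "- 0\<^sub>m r c = (0\<^sub>m r c :: 'a::ring_1 mat)"
  by (rule eq_matI) auto

section \<open>The matrix J and its inverse\<close>

definition J_inv :: "nat \<Rightarrow> nat \<Rightarrow> 'a::ring_1 mat" where
  "J_inv m n = four_block_mat (0\<^sub>m m n) (- 1\<^sub>m m) (1\<^sub>m n) (0\<^sub>m n m)"

lemma J_carrier [simp]: "J_mat m n \<in> carrier_mat (n + m) (m + n)" "J_inv m n \<in> carrier_mat (m + n) (n + m)"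
  by (simp_all add: J_mat_def J_inv_def)

lemma J_carrier' [simp]: "J_mat m n \<in> carrier_mat (m + n) (m + n)" "J_inv m n \<in> carrier_mat (m + n) (m + n)"
  using J_carrier[of m n] by (simp_all add: add.commute)

lemma J_J_inv: "J_mat m n * J_inv m n = (1\<^sub>m (m + n) :: 'a::ring_1 mat)"
  "J_inv m n * J_mat m n = (1\<^sub>m (m + n) :: 'a::ring_1 mat)"
proof -
  have "J_mat m n * J_inv m n = (four_block_mat (1\<^sub>m n) (0\<^sub>m n m) (0\<^sub>m m n) (1\<^sub>m m) :: 'a mat)"
    unfolding J_mat_def J_inv_def
    by (subst mult_four_block_mat[where ?nr1.0 = n and ?nr2.0 = m and ?n1.0 = m and ?n2.0 = n and ?nc1.0 = n and ?nc2.0 = m])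
      auto
  then show "J_mat m n * J_inv m n = (1\<^sub>m (m + n) :: 'a::ring_1 mat)" by (simp add: add.commute)
  have "J_inv m n * J_mat m n = (four_block_mat (1\<^sub>m m) (0\<^sub>m m n) (0\<^sub>m n m) (1\<^sub>m n) :: 'a mat)"
    unfolding J_mat_def J_inv_def
    by (subst mult_four_block_mat[where ?nr1.0 = m and ?nr2.0 = n and ?n1.0 = n and ?n2.0 = m and ?nc1.0 = m and ?nc2.0 = n])
      auto
  then show "J_inv m n * J_mat m n = (1\<^sub>m (m + n) :: 'a::ring_1 mat)" by simp
qed

lemma mat_inv_J: "mat_inv (J_mat m n) = J_inv m n"
  by (rule mat_inv_eq[OF J_carrier' J_J_inv])

text \<open>With the block sizes exchanged the products give minus the identity; in
  \<open>bar_bar\<close> this sign occurs twice and cancels.\<close>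

lemma J_J_swap: "J_mat n m * J_mat m n = (- 1\<^sub>m (m + n) :: 'a::ring_1 mat)"
  "J_inv m n * J_inv n m = (- 1\<^sub>m (m + n) :: 'a::ring_1 mat)"
proof -
  have one: "four_block_mat (- 1\<^sub>m m) (0\<^sub>m m n) (0\<^sub>m n m) (- 1\<^sub>m n) = (- 1\<^sub>m (m + n) :: 'a mat)"
    by (rule eq_matI) auto
  have "J_mat n m * J_mat m n = (four_block_mat (- 1\<^sub>m m) (0\<^sub>m m n) (0\<^sub>m n m) (- 1\<^sub>m n) :: 'a mat)"
    unfolding J_mat_def
    by (subst mult_four_block_mat[where ?nr1.0 = m and ?nr2.0 = n and ?n1.0 = n and ?n2.0 = m and ?nc1.0 = m and ?nc2.0 = n])
      auto
  then show "J_mat n m * J_mat m n = (- 1\<^sub>m (m + n) :: 'a mat)" by (simp add: one)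
  have "J_inv m n * J_inv n m = (four_block_mat (- 1\<^sub>m m) (0\<^sub>m m n) (0\<^sub>m n m) (- 1\<^sub>m n) :: 'a mat)"
    unfolding J_inv_def
    by (subst mult_four_block_mat[where ?nr1.0 = m and ?nr2.0 = n and ?n1.0 = n and ?n2.0 = m and ?nc1.0 = m and ?nc2.0 = n])
      auto
  then show "J_inv m n * J_inv n m = (- 1\<^sub>m (m + n) :: 'a mat)" by (simp add: one)
qed

section \<open>Daggered copies of matrices and equations\<close>

locale involution_pair =
  fixes cmp crc :: "'a::division_ring \<Rightarrow> 'a"
  assumes cmp: "involutory_automorphism cmp" and crc: "involutory_anti_automorphism crc"
begin

lemma cmp_facts: "cmp (cmp a) = a" "ring_hom_fun cmp"
proof -
  show inv: "cmp (cmp a) = a" for a using cmp by (simp add: involutory_automorphism_def)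
  have mult: "cmp (a * b) = cmp a * cmp b" for a b using cmp by (simp add: involutory_automorphism_def)
  have "cmp 1 = 1" using mult[of 1 "cmp 1"] by (simp add: inv)
  then show "ring_hom_fun cmp"
    using cmp by (simp add: involutory_automorphism_def ring_hom_fun_def)
qed

lemma crc_facts: "crc (crc a) = a" "crc (a + b) = crc a + crc b" "crc (a * b) = crc b * crc a"
  "crc 1 = 1" "crc 0 = 0" "crc (- a) = - crc a" "crc (sum f S) = (\<Sum>x\<in>S. crc (f x))"
proof -
  show inv: "crc (crc a) = a" for a using crc by (simp add: involutory_anti_automorphism_def)
  show add: "crc (a + b) = crc a + crc b" for a b
    using crc by (simp add: involutory_anti_automorphism_def)
  show mult: "crc (a * b) = crc b * crc a" for a b
    using crc by (simp add: involutory_anti_automorphism_def)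
  show "crc 1 = 1" using mult[of "crc 1" 1] by (simp add: inv)
  show zero: "crc 0 = 0" using add[of 0 0] by simp
  show "crc (- a) = - crc a" using add[of "- a" a] zero by (simp add: eq_neg_iff_add_eq_0)
  show "crc (sum f S) = (\<Sum>x\<in>S. crc (f x))"
    by (induction S rule: infinite_finite_induct) (auto simp: zero add)
qed

text \<open>Differs from \<open>cmp\<close> unless \<open>cmp\<close> and \<open>crc\<close> commute.\<close>

definition cmp' :: "'a \<Rightarrow> 'a" where
  "cmp' a = crc (cmp (crc a))"

lemma cmp'_facts: "cmp' (cmp' a) = a" "ring_hom_fun cmp'" "crc (cmp a) = cmp' (crc a)" "crc (cmp' a) = cmp (crc a)"
  using ring_hom_funD[OF cmp_facts(2)]
  by (simp_all add: cmp'_def crc_facts cmp_facts(1) ring_hom_fun_def)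

definition dg :: "'a mat \<Rightarrow> 'a mat" where
  "dg A = transpose_mat (map_mat crc A)"

lemma dg_carrier [simp]: "dg A \<in> carrier_mat r c \<longleftrightarrow> A \<in> carrier_mat c r"
  by (auto simp: dg_def)

lemma dg_dim [simp]: "dim_row (dg A) = dim_col A" "dim_col (dg A) = dim_row A"
  by (simp_all add: dg_def)

lemma dg_index [simp]: "r < dim_col A \<Longrightarrow> c < dim_row A \<Longrightarrow> dg A $$ (r, c) = crc (A $$ (c, r))"
  by (simp add: dg_def)

lemma dg_dg [simp]: "dg (dg A) = A"
  by (rule eq_matI) (simp_all add: crc_facts)

lemma dg_mult:
  assumes A: "A \<in> carrier_mat a b" and B: "B \<in> carrier_mat b c"
  shows "dg (A * B) = dg B * dg A"
  using A B by (intro eq_matI) (auto simp: scalar_prod_def crc_facts intro!: sum.cong)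

lemma dg_simps: "dg (1\<^sub>m n) = 1\<^sub>m n" "dg (0\<^sub>m r c) = 0\<^sub>m c r" "dg (- A) = - dg A"
  by (rule eq_matI; auto simp: crc_facts)+

lemma dg_minus:
  assumes "A \<in> carrier_mat r c" "B \<in> carrier_mat r c"
  shows "dg (A - B) = dg A - dg B"
  using assms crc_facts(2)[of _ "- _"] by (intro eq_matI) (auto simp: crc_facts simp flip: add_uminus_conv_diff)

lemma dg_map: "dg (map_mat cmp A) = map_mat cmp' (dg A)" "dg (map_mat cmp' A) = map_mat cmp (dg A)"
  by (rule eq_matI; auto simp: cmp'_facts)+

lemma dg_four_block:
  assumes "A \<in> carrier_mat nr1 nc1" "B \<in> carrier_mat nr1 nc2" "C \<in> carrier_mat nr2 nc1" "D \<in> carrier_mat nr2 nc2"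
  shows "dg (four_block_mat A B C D) = four_block_mat (dg A) (dg C) (dg B) (dg D)"
  unfolding dg_def map_four_block_mat[OF assms]
  by (rule transpose_four_block_mat) (use assms in auto)

lemma dg_J: "dg (J_mat m n) = J_inv m n" "dg (J_inv m n) = J_mat m n"
proof -
  show "dg (J_mat m n) = J_inv m n"
    unfolding J_mat_def J_inv_def
    by (subst dg_four_block[where ?nr1.0 = n and ?nr2.0 = m and ?nc1.0 = m and ?nc2.0 = n]) (auto simp: dg_simps)
  then show "dg (J_inv m n) = J_mat m n" by (metis dg_dg)
qed

lemma map_J:
  assumes "ring_hom_fun f"
  shows "map_mat f (J_mat m n) = J_mat m n" "map_mat f (J_inv m n) = J_inv m n"
  unfolding J_mat_def J_inv_def
  by (subst map_four_block_mat[where ?nr1.0 = n and ?nr2.0 = m and ?nc1.0 = m and ?nc2.0 = n]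
      map_four_block_mat[where ?nr1.0 = m and ?nr2.0 = n and ?nc1.0 = n and ?nc2.0 = m];
    auto simp: map_mat_ring_hom[OF assms])+

text \<open>For \<open>W\<close> inverse to \<open>P\<close>, this is \<open>P\<close> raised to the exponent \<open>Dagger\<close> in the sense of
  \<open>angle_exp\<close>.\<close>

definition bar :: "nat \<Rightarrow> nat \<Rightarrow> 'a mat \<Rightarrow> 'a mat" where
  "bar m n W = J_mat m n * dg W * J_inv m n"

lemma bar_carrier [simp]: "bar m n W \<in> carrier_mat (m + n) (m + n)"
  if "W \<in> carrier_mat (m + n) (m + n)"
  unfolding bar_def using that by (intro mult_carrier_mat[of _ _ "m + n"]) auto

lemma bar_mult:
  assumes "W \<in> carrier_mat (m + n) (m + n)" "P \<in> carrier_mat (m + n) (m + n)" "P * W = 1\<^sub>m (m + n)"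
  shows "bar m n W * bar m n P = 1\<^sub>m (m + n)"
proof -
  let ?J = "J_mat m n :: 'a mat" and ?K = "J_inv m n :: 'a mat" and ?n = "m + n"
  have c: "?J \<in> carrier_mat ?n ?n" "?K \<in> carrier_mat ?n ?n" "dg W \<in> carrier_mat ?n ?n" "dg P \<in> carrier_mat ?n ?n"
    using assms by auto
  have "bar m n W * bar m n P = ?J * dg W * (?K * ?J) * dg P * ?K"
    unfolding bar_def using c
    by (simp add: assoc_mult_mat[of _ ?n ?n _ ?n _ ?n] mult_carrier_mat[of _ ?n ?n _ ?n] del: dg_carrier)
  also have "\<dots> = ?J * (dg W * dg P) * ?K"
    using c
    by (simp add: J_J_inv left_mult_one_mat[of _ ?n ?n] assoc_mult_mat[of _ ?n ?n _ ?n _ ?n]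
        mult_carrier_mat[of _ ?n ?n _ ?n] del: dg_carrier)
  also have "dg W * dg P = 1\<^sub>m ?n"
    using dg_mult[OF assms(2,1)] assms(3) by (simp add: dg_simps)
  finally show ?thesis using c by (simp add: J_J_inv)
qed

lemma bar_map:
  assumes W: "W \<in> carrier_mat (m + n) (m + n)"
  shows "bar m n (map_mat cmp W) = map_mat cmp' (bar m n W)" "bar m n (map_mat cmp' W) = map_mat cmp (bar m n W)"
proof -
  have JW: "J_mat m n * dg W \<in> carrier_mat (m + n) (m + n)"
    using W by (intro mult_carrier_mat[of _ _ "m + n"]) auto
  have dW: "dg W \<in> carrier_mat (m + n) (m + n)" using W by simp
  note mult = map_mat_mult[OF _ JW J_carrier'(2)] map_mat_mult[OF _ J_carrier'(1) dW]
  show "bar m n (map_mat cmp W) = map_mat cmp' (bar m n W)"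
    by (simp only: bar_def dg_map mult[OF cmp'_facts(2)] map_J[OF cmp'_facts(2)])
  show "bar m n (map_mat cmp' W) = map_mat cmp (bar m n W)"
    by (simp only: bar_def dg_map mult[OF cmp_facts(2)] map_J[OF cmp_facts(2)])
qed

text \<open>The daggered copy has its blocks in the opposite order, so the second application uses
  exchanged sizes.\<close>

lemma bar_bar:
  assumes W: "W \<in> carrier_mat (m + n) (m + n)"
  shows "bar n m (bar m n W) = W"
proof -
  let ?J = "J_mat m n :: 'a mat" and ?K = "J_inv m n :: 'a mat" and ?n = "m + n"
  let ?J' = "J_mat n m :: 'a mat" and ?K' = "J_inv n m :: 'a mat"
  have c: "?J \<in> carrier_mat ?n ?n" "?K \<in> carrier_mat ?n ?n" "?J' \<in> carrier_mat ?n ?n" "?K' \<in> carrier_mat ?n ?n"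
    "dg W \<in> carrier_mat ?n ?n" "?J * dg W \<in> carrier_mat ?n ?n"
    using W J_carrier'[of n m] by (auto simp: add.commute intro!: mult_carrier_mat[of _ _ ?n])
  have "dg (bar m n W) = ?J * (W * ?K)"
    unfolding bar_def dg_mult[OF c(6,2)] dg_mult[OF c(1,5)] by (simp add: dg_J)
  then have "bar n m (bar m n W) = ?J' * ?J * W * (?K * ?K')"
    unfolding bar_def[of n m] using c W
    by (simp add: assoc_mult_mat[of _ ?n ?n _ ?n _ ?n] mult_carrier_mat[of _ ?n ?n _ ?n] del: dg_carrier)
  also have "\<dots> = W" using W by (simp add: J_J_swap)
  finally show ?thesis .
qed

text \<open>\<open>dg\<close> reverses products, so it turns the identity into
  \<open>dg M * dg D = dg T * dg M'\<close>, and multiplying by the inverses gives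
  \<open>dg D * dg W' = dg W * dg T\<close>. Conjugation by J exchanges the diagonal blocks and
  makes the lower triangular \<open>dg T\<close> upper triangular again, with a sign at
  \<open>dg C\<close>. Source and target of the equation are interchanged.\<close>

lemma dual_equation:
  assumes A: "A \<in> carrier_mat p' p" and B: "B \<in> carrier_mat q' q" and C: "C \<in> carrier_mat p' q"
    and M: "M \<in> carrier_mat (p + q) (p + q)" "W \<in> carrier_mat (p + q) (p + q)" "M * W = 1\<^sub>m (p + q)"
    and M': "M' \<in> carrier_mat (p' + q') (p' + q')" "W' \<in> carrier_mat (p' + q') (p' + q')" "W' * M' = 1\<^sub>m (p' + q')"
    and eq: "four_block_mat A (0\<^sub>m p' q) (0\<^sub>m q' p) B * M = M' * four_block_mat A C (0\<^sub>m q' p) B"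
  shows "four_block_mat (dg B) (0\<^sub>m q p') (0\<^sub>m p q') (dg A) * bar p' q' W' =
    bar p q W * four_block_mat (dg B) (- dg C) (0\<^sub>m p q') (dg A)"
proof -
  let ?D = "four_block_mat A (0\<^sub>m p' q) (0\<^sub>m q' p) B" and ?T = "four_block_mat A C (0\<^sub>m q' p) B"
  let ?D' = "four_block_mat (dg B) (0\<^sub>m q p') (0\<^sub>m p q') (dg A)"
  let ?T' = "four_block_mat (dg B) (- dg C) (0\<^sub>m p q') (dg A)"
  let ?n = "p + q" and ?n' = "p' + q'"
  let ?J = "J_mat p q :: 'a mat" and ?K = "J_inv p q :: 'a mat"
  let ?J' = "J_mat p' q' :: 'a mat" and ?K' = "J_inv p' q' :: 'a mat"
  have D: "?D \<in> carrier_mat ?n' ?n" "?T \<in> carrier_mat ?n' ?n" using A B C by auto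
  have "?D' \<in> carrier_mat (q + p) (q' + p')" "?T' \<in> carrier_mat (q + p) (q' + p')" using A B C by auto
  then have D': "?D' \<in> carrier_mat ?n ?n'" "?T' \<in> carrier_mat ?n ?n'" by (simp_all add: add.commute)
  have dgD: "dg ?D = four_block_mat (dg A) (0\<^sub>m p q') (0\<^sub>m q p') (dg B)"
    "dg ?T = four_block_mat (dg A) (0\<^sub>m p q') (dg C) (dg B)"
    using A B C by (simp_all add: dg_four_block[of _ p' p _ q _ q'] dg_simps)
  have JD: "?D' * ?J' = ?J * dg ?D"
  proof -
    have "?D' * ?J' = four_block_mat (0\<^sub>m q p') (dg B) (- dg A) (0\<^sub>m p q')"
      unfolding J_mat_def using A B
      by (subst mult_four_block_mat[where ?nr1.0 = q and ?nr2.0 = p and ?n1.0 = q' and ?n2.0 = p' and ?nc1.0 = p' and ?nc2.0 = q'])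
        auto
    moreover have "?J * dg ?D = four_block_mat (0\<^sub>m q p') (dg B) (- dg A) (0\<^sub>m p q')"
      unfolding J_mat_def dgD using A B
      by (subst mult_four_block_mat[where ?nr1.0 = q and ?nr2.0 = p and ?n1.0 = p and ?n2.0 = q and ?nc1.0 = p' and ?nc2.0 = q'])
        auto
    ultimately show ?thesis by simp
  qed
  have JT: "?T' * ?J' = ?J * dg ?T"
  proof -
    have "?T' * ?J' = four_block_mat (dg C) (dg B) (- dg A) (0\<^sub>m p q')"
      unfolding J_mat_def using A B C
      by (subst mult_four_block_mat[where ?nr1.0 = q and ?nr2.0 = p and ?n1.0 = q' and ?n2.0 = p' and ?nc1.0 = p' and ?nc2.0 = q'])
        auto
    moreover have "?J * dg ?T = four_block_mat (dg C) (dg B) (- dg A) (0\<^sub>m p q')"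
      unfolding J_mat_def dgD using A B C
      by (subst mult_four_block_mat[where ?nr1.0 = q and ?nr2.0 = p and ?n1.0 = p and ?n2.0 = q and ?nc1.0 = p' and ?nc2.0 = q'])
        auto
    ultimately show ?thesis by simp
  qed
  have c: "dg ?D \<in> carrier_mat ?n ?n'" "dg ?T \<in> carrier_mat ?n ?n'" "dg M \<in> carrier_mat ?n ?n" "dg W \<in> carrier_mat ?n ?n"
    "dg M' \<in> carrier_mat ?n' ?n'" "dg W' \<in> carrier_mat ?n' ?n'"
    using D M M' by simp_all
  have deq: "dg M * dg ?D = dg ?T * dg M'"
    using arg_cong[OF eq, of dg] dg_mult[OF D(1) M(1)] dg_mult[OF M'(1) D(2)] by simp
  have inv: "dg W * dg M = 1\<^sub>m ?n" "dg M' * dg W' = 1\<^sub>m ?n'"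
    using dg_mult[OF M(1,2)] dg_mult[OF M'(2,1)] M(3) M'(3) by (simp_all add: dg_simps)
  note assoc = assoc_mult_mat[of _ ?n ?n _ ?n _ ?n] assoc_mult_mat[of _ ?n ?n _ ?n _ ?n']
    assoc_mult_mat[of _ ?n ?n _ ?n' _ ?n'] assoc_mult_mat[of _ ?n ?n' _ ?n' _ ?n']
    mult_carrier_mat[of _ ?n ?n _ ?n] mult_carrier_mat[of _ ?n ?n _ ?n'] mult_carrier_mat[of _ ?n ?n' _ ?n']
    mult_carrier_mat[of _ ?n' ?n' _ ?n'] assoc_mult_mat[of _ ?n' ?n' _ ?n' _ ?n']
  have "dg ?D * dg W' = (dg W * dg M) * dg ?D * dg W'"
    unfolding inv left_mult_one_mat[OF c(1)] ..
  also have "\<dots> = dg W * (dg M * dg ?D) * dg W'"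
    using c by (simp add: assoc del: dg_carrier)
  also have "\<dots> = dg W * (dg ?T * (dg M' * dg W'))"
    unfolding deq using c by (simp add: assoc del: dg_carrier)
  also have "\<dots> = dg W * dg ?T"
    unfolding inv right_mult_one_mat[OF c(2)] ..
  finally have DW: "dg ?D * dg W' = dg W * dg ?T" .
  have J: "?J \<in> carrier_mat ?n ?n" "?K \<in> carrier_mat ?n ?n" "?J' \<in> carrier_mat ?n' ?n'" "?K' \<in> carrier_mat ?n' ?n'"
    by simp_all
  have "?D' * bar p' q' W' = ?D' * ?J' * dg W' * ?K'"
    unfolding bar_def using c D' J by (simp add: assoc del: dg_carrier)
  also have "\<dots> = ?J * (dg ?D * dg W') * ?K'"
    unfolding JD using c J by (simp add: assoc del: dg_carrier)
  also have "\<dots> = ?J * dg W * (?K * ?J) * dg ?T * ?K'"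
    unfolding DW J_J_inv using c J by (simp add: assoc left_mult_one_mat[of _ ?n ?n'] right_mult_one_mat[of _ ?n ?n] del: dg_carrier)
  also have "\<dots> = ?J * dg W * ?K * (?J * dg ?T) * ?K'"
    using c J by (simp add: assoc del: dg_carrier)
  also have "\<dots> = bar p q W * (?T' * (?J' * ?K'))"
    unfolding bar_def JT[symmetric] using c D' J by (simp add: assoc del: dg_carrier)
  also have "\<dots> = bar p q W * ?T'"
    unfolding J_J_inv right_mult_one_mat[OF D'(2)] ..
  finally show ?thesis .
qed

end

section \<open>Exponents and averaging\<close>

text \<open>An exponent is recorded by two flags, \<open>Star\<close> having both: this one selects
  the copy of the unknown, and \<open>is_twisted\<close> tells whether the automorphism of that copy
  is applied.\<close>

definition is_dual :: "exponent \<Rightarrow> bool" where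
  "is_dual \<sigma> \<longleftrightarrow> \<sigma> \<in> {Dagger, Star}"

definition is_twisted :: "exponent \<Rightarrow> bool" where
  "is_twisted \<sigma> \<longleftrightarrow> \<sigma> \<in> {Compl, Star}"

lemma exp_dims: "exp_rows \<sigma> m n = (if is_dual \<sigma> then n else m)" "exp_cols \<sigma> m n = (if is_dual \<sigma> then m else n)"
  by (cases \<sigma>; simp add: exp_rows_def exp_cols_def is_dual_def)+

lemma invertible_matE:
  fixes P :: "'a::ring_1 mat"
  assumes "invertible_mat P" and P: "P \<in> carrier_mat k k"
  obtains W where "W \<in> carrier_mat k k" "P * W = 1\<^sub>m k" "W * P = 1\<^sub>m k"
proof -
  obtain W where W: "P * W = 1\<^sub>m k" "W * P = 1\<^sub>m (dim_row W)"
    using assms by (auto simp: invertible_mat_def inverts_mat_def)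
  have "dim_col W = k" "dim_row W = k"
    using arg_cong[OF W(1), of dim_col] arg_cong[OF W(2), of dim_col] P by auto
  then show ?thesis using that[of W] W by auto
qed

lemma char_not_two:
  assumes "CHAR('a::division_ring) \<noteq> 2"
  shows "(2 :: 'a) \<noteq> 0"
proof
  assume "(2 :: 'a) = 0"
  then have "of_nat 2 = (0 :: 'a)" by simp
  then have "CHAR('a) dvd 2" by (simp only: of_nat_eq_0_iff_char_dvd)
  then have "CHAR('a) \<le> 2" "0 < CHAR('a)"
    using dvd_imp_le[of "CHAR('a)" 2] dvd_pos_nat[of 2 "CHAR('a)"] by simp_all
  moreover have "CHAR('a) \<noteq> 1" by simp
  ultimately show False using assms by linarith
qed

definition half :: "'a::division_ring" where
  "half = inverse 2"

text \<open>2 is central, hence so is its inverse; as the only solution of \<open>2 * x = 1\<close>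
  it is fixed by every ring homomorphism.\<close>

lemma half_facts:
  assumes two: "(2 :: 'a::division_ring) \<noteq> 0"
  shows "half * a = a * (half :: 'a)" "half * (a + a) = a" "2 * (x :: 'a) = 1 \<Longrightarrow> x = half"
    "ring_hom_fun f \<Longrightarrow> f half = (half :: 'a)"
proof -
  have h: "2 * half = (1 :: 'a)" "half * 2 = (1 :: 'a)"
    unfolding half_def by (rule right_inverse[OF two], rule left_inverse[OF two])
  show "half * a = a * half"
    unfolding half_def by (rule mult_commute_imp_mult_inverse_commute) (simp add: mult_2 mult_2_right)
  show "half * (a + a) = a" using h(2) by (simp flip: mult_2 mult.assoc)
  have half: "y = half" if "2 * y = 1" for y :: 'a
    using that h(2) by (metis mult.assoc mult_1_left mult_1_right)
  then show "2 * x = 1 \<Longrightarrow> x = half" .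
  assume f: "ring_hom_fun f"
  have "2 * f half = f (2 * half)"
    by (simp only: mult_2 ring_hom_funD(3)[OF f])
  then show "f half = half" using h(1) ring_hom_funD(1)[OF f] half by simp
qed

definition avg :: "'a::division_ring mat \<Rightarrow> 'a mat \<Rightarrow> 'a mat" where
  "avg Y Z = map_mat (\<lambda>x. half * x) (Y + Z)"

lemma avg_carrier [simp]: "Y \<in> carrier_mat r c \<Longrightarrow> Z \<in> carrier_mat r c \<Longrightarrow> avg Y Z \<in> carrier_mat r c"
  by (simp add: avg_def)

lemma avg_self: "(2 :: 'a::division_ring) \<noteq> 0 \<Longrightarrow> avg C C = (C :: 'a mat)"
  by (rule eq_matI) (simp_all add: avg_def half_facts(2))

lemma avg_commute: "Y \<in> carrier_mat r c \<Longrightarrow> Z \<in> carrier_mat r c \<Longrightarrow> avg Y Z = avg Z Y"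
  by (simp add: avg_def comm_add_mat[of Y r c])

lemma avg_diff:
  assumes "Y \<in> carrier_mat r c" "Z \<in> carrier_mat r c" "Y' \<in> carrier_mat r c" "Z' \<in> carrier_mat r c"
  shows "avg Y Z - avg Y' Z' = avg (Y - Y') (Z - Z')"
  using assms by (intro eq_matI) (auto simp: avg_def right_diff_distrib[symmetric])

lemma mult_avg:
  assumes two: "(2 :: 'a::division_ring) \<noteq> 0"
    and "A \<in> carrier_mat p r" "Y \<in> carrier_mat r c" "Z \<in> carrier_mat r (c :: nat)"
  shows "(A :: 'a mat) * avg Y Z = avg (A * Y) (A * Z)"
proof -
  have "a * (half * x) = half * (a * x)" for a x :: 'a
    using half_facts(1)[OF two, of a] by (metis mult.assoc)
  then show ?thesis
    using assms(2-) by (intro eq_matI)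
      (auto simp: avg_def scalar_prod_def sum_distrib_left distrib_left sum.distrib)
qed

lemma avg_mult:
  assumes "B \<in> carrier_mat c q" "Y \<in> carrier_mat r c" "Z \<in> carrier_mat r c"
  shows "avg Y Z * B = avg (Y * B) (Z * B)"
  using assms by (intro eq_matI)
    (auto simp: avg_def scalar_prod_def sum_distrib_left distrib_left distrib_right sum.distrib mult.assoc)

lemma map_avg:
  assumes "(2 :: 'a::division_ring) \<noteq> 0" "ring_hom_fun f" "Y \<in> carrier_mat r c" "Z \<in> carrier_mat r c"
  shows "map_mat f (avg Y Z) = avg (map_mat f Y) (map_mat f (Z :: 'a mat))"
  using assms by (intro eq_matI) (auto simp: avg_def ring_hom_funD half_facts(4))

lemma twist_mat_inverse:
  assumes "ring_hom_fun f" "P \<in> carrier_mat k k" "W \<in> carrier_mat k k" "P * W = 1\<^sub>m k"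
  shows "twist_mat f b P * twist_mat f b W = 1\<^sub>m k"
  using map_mat_mult[OF assms(1-3)] assms(4) map_mat_ring_hom(1)[OF assms(1)] by (auto simp: twist_mat_def)

lemma unitriangular_inverse:
  assumes X: "X \<in> carrier_mat m n"
  shows "four_block_mat (1\<^sub>m m) X (0\<^sub>m n m) (1\<^sub>m n) * four_block_mat (1\<^sub>m m) (- X) (0\<^sub>m n m) (1\<^sub>m n) =
      (1\<^sub>m (m + n) :: 'a::ring_1 mat)"
proof -
  have "- X + X = 0\<^sub>m m n" by (rule uminus_l_inv_mat[OF X])
  then have "four_block_mat (1\<^sub>m m) X (0\<^sub>m n m) (1\<^sub>m n) * four_block_mat (1\<^sub>m m) (- X) (0\<^sub>m n m) (1\<^sub>m n) =
      (four_block_mat (1\<^sub>m m) (0\<^sub>m m n) (0\<^sub>m n m) (1\<^sub>m n) :: 'a mat)"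
    using X
    by (subst mult_four_block_mat[where ?nr1.0 = m and ?nr2.0 = n and ?n1.0 = m and ?n2.0 = n and ?nc1.0 = m and ?nc2.0 = n])
      auto
  then show ?thesis by simp
qed

context involution_pair begin

lemma dg_avg:
  assumes "(2 :: 'a) \<noteq> 0" "Y \<in> carrier_mat r c" "Z \<in> carrier_mat r c"
  shows "dg (avg Y Z) = avg (dg Y) (dg Z)"
proof -
  have "2 * crc half = crc (half + half)" by (simp only: mult_2 crc_facts)
  also have "half + half = (1 :: 'a)" using half_facts(2)[OF assms(1), of 1]
    by (simp only: distrib_left mult_1_right)
  finally have "crc half = half" using half_facts(3)[OF assms(1)] by (simp add: crc_facts)
  then show ?thesis
    using assms half_facts(1)[OF assms(1)] by (intro eq_matI) (auto simp: avg_def crc_facts)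
qed

text \<open>The flag \<open>True\<close> stands for the daggered copies, on which \<open>cmp\<close>
  acts through its conjugate \<open>cmp'\<close>.\<close>

definition twist :: "bool \<Rightarrow> 'a \<Rightarrow> 'a" where
  "twist b = (if b then cmp' else cmp)"

lemma twist_hom: "ring_hom_fun (twist b)"
  by (simp add: twist_def cmp_facts cmp'_facts)

lemma dg_twist: "dg (twist_mat (twist b) t X) = twist_mat (twist (\<not> b)) t (dg X)"
  by (simp add: twist_mat_def twist_def dg_map)

text \<open>Moving \<open>crc\<close> past \<open>cmp\<close> in \<open>Star\<close> replaces
  \<open>cmp\<close> by \<open>cmp'\<close>, so that the automorphism is applied last.\<close>

lemma mat_exp_twist: "mat_exp cmp crc X \<sigma> =
    twist_mat (twist (is_dual \<sigma>)) (is_twisted \<sigma>) (if is_dual \<sigma> then dg X else X)"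
  by (cases \<sigma>; simp add: is_dual_def is_twisted_def twist_mat_def twist_def dg_def[symmetric] dg_map)

text \<open>\<open>dg\<close> and the automorphism carry inverses to inverses, so for dual exponents
  the inverse inside \<open>angle_exp\<close> is the image of \<open>W\<close>;
  \<open>bar_map\<close> then moves the twist outside.\<close>

lemma angle_exp_twist:
  assumes P: "P \<in> carrier_mat (m + n) (m + n)" "W \<in> carrier_mat (m + n) (m + n)"
    and PW: "P * W = 1\<^sub>m (m + n)" "W * P = 1\<^sub>m (m + n)"
  shows "angle_exp cmp crc m n P \<sigma> =
    twist_mat (twist (is_dual \<sigma>)) (is_twisted \<sigma>) (if is_dual \<sigma> then bar m n W else P)"
proof (cases "is_dual \<sigma>")
  case False
  then show ?thesis by (simp add: angle_exp_def mat_exp_twist) (cases \<sigma>; simp add: is_dual_def)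
next
  case True
  let ?t = "twist_mat cmp (is_twisted \<sigma>)"
  have E: "mat_exp cmp crc P \<sigma> = dg (?t P)"
    using True dg_twist[of False] by (simp add: mat_exp_twist twist_def)
  have inv: "?t P * ?t W = 1\<^sub>m (m + n)" "?t W * ?t P = 1\<^sub>m (m + n)"
    using twist_mat_inverse[OF cmp_facts(2)] P PW by blast+
  have "mat_inv (dg (?t P)) = dg (?t W)"
  proof (rule mat_inv_eq)
    show "dg (?t P) \<in> carrier_mat (m + n) (m + n)" "dg (?t W) \<in> carrier_mat (m + n) (m + n)"
      using P by simp_all
    show "dg (?t P) * dg (?t W) = 1\<^sub>m (m + n)" "dg (?t W) * dg (?t P) = 1\<^sub>m (m + n)"
      using dg_mult[of "?t W" "m + n" "m + n" "?t P" "m + n"] dg_mult[of "?t P" "m + n" "m + n" "?t W" "m + n"] P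
      unfolding inv dg_simps by simp_all
  qed
  then have "angle_exp cmp crc m n P \<sigma> = bar m n (?t W)"
    using True by (simp add: angle_exp_def is_dual_def E mat_inv_J bar_def) (auto simp: E mat_inv_J)
  also have "\<dots> = twist_mat cmp' (is_twisted \<sigma>) (bar m n W)"
    using bar_map(1)[OF P(2)] by (simp add: twist_mat_def)
  finally show ?thesis using True by (simp add: twist_def)
qed

text \<open>This explains the form of \<open>angle_exp\<close>: the dagger makes the matrix lower
  unitriangular, inversion negates the off-diagonal block, and conjugation by J returns it to the
  upper right and restores its sign.\<close>

lemma angle_exp_unitriangular:
  assumes X: "X \<in> carrier_mat m n"
  shows "angle_exp cmp crc m n (four_block_mat (1\<^sub>m m) X (0\<^sub>m n m) (1\<^sub>m n)) \<sigma> =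
    four_block_mat (1\<^sub>m (exp_rows \<sigma> m n)) (mat_exp cmp crc X \<sigma>)
      (0\<^sub>m (exp_cols \<sigma> m n) (exp_rows \<sigma> m n)) (1\<^sub>m (exp_cols \<sigma> m n))"
proof -
  let ?P = "four_block_mat (1\<^sub>m m) X (0\<^sub>m n m) (1\<^sub>m n)" and ?W = "four_block_mat (1\<^sub>m m) (- X) (0\<^sub>m n m) (1\<^sub>m n)"
  have PW: "?P * ?W = 1\<^sub>m (m + n)" "?W * ?P = 1\<^sub>m (m + n)"
    using unitriangular_inverse[OF X] unitriangular_inverse[of "- X" m n] X by simp_all
  have car: "?P \<in> carrier_mat (m + n) (m + n)" "?W \<in> carrier_mat (m + n) (m + n)" by simp_all
  have block: "twist_mat (twist b) t (four_block_mat (1\<^sub>m k) Y (0\<^sub>m l k) (1\<^sub>m l)) =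
      four_block_mat (1\<^sub>m k) (twist_mat (twist b) t Y) (0\<^sub>m l k) (1\<^sub>m l)" if "Y \<in> carrier_mat k l" for b t k l Y
    using that map_four_block_mat[of "1\<^sub>m k" k k Y l "0\<^sub>m l k" l "1\<^sub>m l" "twist b"]
    by (auto simp: twist_mat_def map_mat_ring_hom[OF twist_hom])
  have "bar m n ?W = four_block_mat (1\<^sub>m n) (dg X) (0\<^sub>m m n) (1\<^sub>m m)"
  proof -
    have "dg ?W = four_block_mat (1\<^sub>m m) (0\<^sub>m m n) (- dg X) (1\<^sub>m n)"
      using X by (simp add: dg_four_block[of _ m m _ n _ n] dg_simps)
    moreover have "J_mat m n * four_block_mat (1\<^sub>m m) (0\<^sub>m m n) (- dg X) (1\<^sub>m n) =
        four_block_mat (- dg X) (1\<^sub>m n) (- 1\<^sub>m m) (0\<^sub>m m n)"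
      unfolding J_mat_def using X
      by (subst mult_four_block_mat[where ?nr1.0 = n and ?nr2.0 = m and ?n1.0 = m and ?n2.0 = n and ?nc1.0 = m and ?nc2.0 = n])
        auto
    moreover have "four_block_mat (- dg X) (1\<^sub>m n) (- 1\<^sub>m m) (0\<^sub>m m n) * J_inv m n =
        four_block_mat (1\<^sub>m n) (dg X) (0\<^sub>m m n) (1\<^sub>m m)"
      unfolding J_inv_def using X
      by (subst mult_four_block_mat[where ?nr1.0 = n and ?nr2.0 = m and ?n1.0 = m and ?n2.0 = n and ?nc1.0 = n and ?nc2.0 = m])
        auto
    ultimately show ?thesis by (simp add: bar_def)
  qed
  then show ?thesis
    using X by (simp add: angle_exp_twist[OF car PW] mat_exp_twist exp_dims block)
qed

text \<open>\<open>Y\<close> solves for the unknown and \<open>Z\<close> for its daggered copy. A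
  dual exponent exchanges their roles in the average, so every exponent of the average is again an
  average of the two copies.\<close>

lemma mat_exp_avg:
  assumes two: "(2 :: 'a) \<noteq> 0" and Y: "Y \<in> carrier_mat m n" and Z: "Z \<in> carrier_mat n m"
  shows "mat_exp cmp crc (avg Y (dg Z)) \<sigma> =
    avg (twist_mat (twist (is_dual \<sigma>)) (is_twisted \<sigma>) (if is_dual \<sigma> then Z else Y))
      (dg (twist_mat (twist (\<not> is_dual \<sigma>)) (is_twisted \<sigma>) (if is_dual \<sigma> then Y else Z)))"
proof -
  have dZ: "dg Z \<in> carrier_mat m n" and dY: "dg Y \<in> carrier_mat n m" using Y Z by simp_all
  have "dg (avg Y (dg Z)) = avg Z (dg Y)"
    using dg_avg[OF two Y dZ] avg_commute[OF Z dY] by simp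
  then show ?thesis
    using map_avg[OF two cmp_facts(2) Y dZ] map_avg[OF two cmp'_facts(2) Z dY]
    by (auto simp: mat_exp_twist dg_twist twist_mat_def dg_map twist_def)
qed

lemma bar_twist:
  assumes "P \<in> carrier_mat (m + n) (m + n)" "W \<in> carrier_mat (m + n) (m + n)"
  shows "bar m n (twist_mat cmp t W) = twist_mat cmp' t (bar m n W)"
    "bar n m (twist_mat cmp' t (bar m n P)) = twist_mat cmp t P"
proof -
  show "bar m n (twist_mat cmp t W) = twist_mat cmp' t (bar m n W)"
    using bar_map(1)[OF assms(2)] by (simp add: twist_mat_def)
  have "bar m n P \<in> carrier_mat (n + m) (n + m)" using bar_carrier[OF assms(1)] by (simp add: add.commute)
  from bar_map(2)[OF this] show "bar n m (twist_mat cmp' t (bar m n P)) = twist_mat cmp t P"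
    by (simp add: twist_mat_def bar_bar[OF assms(1)])
qed

end

section \<open>Doubling the given system and averaging its solution\<close>

lemma diff_mat_swap:
  "U \<in> carrier_mat r c \<Longrightarrow> V \<in> carrier_mat r c \<Longrightarrow> U - V = - (V - U :: 'a::division_ring mat)"
  by (intro eq_matI) auto

lemma diff_mat_eqD:
  "U \<in> carrier_mat r c \<Longrightarrow> V \<in> carrier_mat r c \<Longrightarrow> U - V = D \<Longrightarrow> U = D + (V :: 'a::division_ring mat)"
  by (intro eq_matI) auto

theorem theorem1:
  fixes cmp crc :: "'a::division_ring \<Rightarrow> 'a"
    and s t :: nat
    and m n :: "nat \<Rightarrow> nat"
    and i' i'' :: "nat \<Rightarrow> nat"
    and \<epsilon> \<delta> :: "nat \<Rightarrow> exponent"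
    and A B C :: "nat \<Rightarrow> 'a mat"
  assumes "CHAR('a) \<noteq> 2"
    and "finite_dim_over_center TYPE('a)"
    and "involutory_automorphism cmp"
    and "involutory_anti_automorphism crc"
    and "\<And>i. i \<in> {1..s} \<Longrightarrow> i' i \<in> {1..t}"
    and "\<And>i. i \<in> {1..s} \<Longrightarrow> i'' i \<in> {1..t}"
    and "\<And>i. i \<in> {1..s} \<Longrightarrow>
      A i \<in> carrier_mat (exp_rows (\<delta> i) (m (i'' i)) (n (i'' i)))
                        (exp_rows (\<epsilon> i) (m (i' i)) (n (i' i)))"
    and "\<And>i. i \<in> {1..s} \<Longrightarrow>
      B i \<in> carrier_mat (exp_cols (\<delta> i) (m (i'' i)) (n (i'' i)))
                        (exp_cols (\<epsilon> i) (m (i' i)) (n (i' i)))"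
    and "\<And>i. i \<in> {1..s} \<Longrightarrow>
      C i \<in> carrier_mat (exp_rows (\<delta> i) (m (i'' i)) (n (i'' i)))
                        (exp_cols (\<epsilon> i) (m (i' i)) (n (i' i)))"
  shows "(\<exists>X :: nat \<Rightarrow> 'a mat.
            (\<forall>j\<in>{1..t}. X j \<in> carrier_mat (m j) (n j)) \<and>
            (\<forall>i\<in>{1..s}.
               A i * mat_exp cmp crc (X (i' i)) (\<epsilon> i)
                 - mat_exp cmp crc (X (i'' i)) (\<delta> i) * B i = C i))
     \<longleftrightarrow> (\<exists>P :: nat \<Rightarrow> 'a mat.
            (\<forall>j\<in>{1..t}. P j \<in> carrier_mat (m j + n j) (m j + n j) \<and> invertible_mat (P j)) \<and>
            (\<forall>i\<in>{1..s}.
               four_block_mat (A i) (0\<^sub>m (dim_row (A i)) (dim_col (B i)))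
                              (0\<^sub>m (dim_row (B i)) (dim_col (A i))) (B i)
                 * angle_exp cmp crc (m (i' i)) (n (i' i)) (P (i' i)) (\<epsilon> i)
               = angle_exp cmp crc (m (i'' i)) (n (i'' i)) (P (i'' i)) (\<delta> i)
                 * four_block_mat (A i) (C i)
                              (0\<^sub>m (dim_row (B i)) (dim_col (A i))) (B i)))"
    (is "?solvable \<longleftrightarrow> ?equivalent")
proof -
  interpret involution_pair cmp crc using assms(3,4) by (rule involution_pair.intro)
  \<comment> \<open>Index \<open>(j, b)\<close> denotes unknown \<open>j\<close> or, for
    \<open>b\<close> true, its daggered copy, in which the block sizes are exchanged.\<close>
  define mm nn :: "nat \<times> bool \<Rightarrow> nat" where "mm v = (if snd v then n (fst v) else m (fst v))"
    and "nn v = (if snd v then m (fst v) else n (fst v))" for v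
  \<comment> \<open>A dual exponent refers to the daggered copy, where only an automorphism is left
    to apply.\<close>
  define src tgt :: "nat \<Rightarrow> nat \<times> bool" where "src i = (i' i, is_dual (\<epsilon> i))"
    and "tgt i = (i'' i, is_dual (\<delta> i))" for i
  have dims: "exp_rows (\<epsilon> i) (m (i' i)) (n (i' i)) = mm (src i)" "exp_cols (\<epsilon> i) (m (i' i)) (n (i' i)) = nn (src i)"
    "exp_rows (\<delta> i) (m (i'' i)) (n (i'' i)) = mm (tgt i)" "exp_cols (\<delta> i) (m (i'' i)) (n (i'' i)) = nn (tgt i)" for i
    by (simp_all add: exp_dims mm_def nn_def src_def tgt_def)
  note i't = assms(5,6) and A = assms(7)[unfolded dims] and B = assms(8)[unfolded dims]
    and C = assms(9)[unfolded dims]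
  show ?thesis
  proof
    assume ?solvable
    then obtain X where X: "\<And>j. j \<in> {1..t} \<Longrightarrow> X j \<in> carrier_mat (m j) (n j)"
      and eq: "\<And>i. i \<in> {1..s} \<Longrightarrow> A i * mat_exp cmp crc (X (i' i)) (\<epsilon> i)
                 - mat_exp cmp crc (X (i'' i)) (\<delta> i) * B i = C i" by blast
    define P where "P j = four_block_mat (1\<^sub>m (m j)) (X j) (0\<^sub>m (n j) (m j)) (1\<^sub>m (n j))" for j
    have "P j \<in> carrier_mat (m j + n j) (m j + n j) \<and> invertible_mat (P j)" if "j \<in> {1..t}" for j
    proof
      show P: "P j \<in> carrier_mat (m j + n j) (m j + n j)" by (simp add: P_def)
      let ?W = "four_block_mat (1\<^sub>m (m j)) (- X j) (0\<^sub>m (n j) (m j)) (1\<^sub>m (n j))"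
      have "P j * ?W = 1\<^sub>m (m j + n j)" "?W * P j = 1\<^sub>m (m j + n j)"
        using unitriangular_inverse[OF X[OF that]] unitriangular_inverse[of "- X j" "m j" "n j"] X[OF that]
        by (simp_all add: P_def)
      then show "invertible_mat (P j)"
        using P unfolding invertible_mat_def inverts_mat_def
        by (intro conjI exI[of _ ?W]) (auto simp: square_mat.simps)
    qed
    moreover have "four_block_mat (A i) (0\<^sub>m (dim_row (A i)) (dim_col (B i)))
            (0\<^sub>m (dim_row (B i)) (dim_col (A i))) (B i) * angle_exp cmp crc (m (i' i)) (n (i' i)) (P (i' i)) (\<epsilon> i)
         = angle_exp cmp crc (m (i'' i)) (n (i'' i)) (P (i'' i)) (\<delta> i) *
           four_block_mat (A i) (C i) (0\<^sub>m (dim_row (B i)) (dim_col (A i))) (B i)" if i: "i \<in> {1..s}" for i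
    proof -
      let ?Xs = "mat_exp cmp crc (X (i' i)) (\<epsilon> i)" and ?Xt = "mat_exp cmp crc (X (i'' i)) (\<delta> i)"
      have Xs: "?Xs \<in> carrier_mat (mm (src i)) (nn (src i))" and Xt: "?Xt \<in> carrier_mat (mm (tgt i)) (nn (tgt i))"
        using X[OF i't(1)[OF i]] X[OF i't(2)[OF i]] by (auto simp: mat_exp_twist mm_def nn_def src_def tgt_def)
      have AX: "A i * ?Xs = C i + ?Xt * B i"
      proof -
        have "A i * ?Xs \<in> carrier_mat (mm (tgt i)) (nn (src i))" "?Xt * B i \<in> carrier_mat (mm (tgt i)) (nn (src i))"
          using A[OF i] B[OF i] Xs Xt by auto
        then show ?thesis by (rule diff_mat_eqD[OF _ _ eq[OF i]])
      qed
      \<comment> \<open>Both products are block triangular with diagonal blocks \<open>A i\<close>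
        and \<open>B i\<close>; their upper right blocks agree by the equation.\<close>
      have "four_block_mat (A i) (0\<^sub>m (mm (tgt i)) (nn (src i))) (0\<^sub>m (nn (tgt i)) (mm (src i))) (B i) *
          four_block_mat (1\<^sub>m (mm (src i))) ?Xs (0\<^sub>m (nn (src i)) (mm (src i))) (1\<^sub>m (nn (src i))) =
        four_block_mat (A i) (A i * ?Xs) (0\<^sub>m (nn (tgt i)) (mm (src i))) (B i)"
        using A[OF i] B[OF i] Xs
        by (subst mult_four_block_mat[where ?nr1.0 = "mm (tgt i)" and ?nr2.0 = "nn (tgt i)" and ?n1.0 = "mm (src i)"
              and ?n2.0 = "nn (src i)" and ?nc1.0 = "mm (src i)" and ?nc2.0 = "nn (src i)"]) auto
      also have "\<dots> = four_block_mat (1\<^sub>m (mm (tgt i))) ?Xt (0\<^sub>m (nn (tgt i)) (mm (tgt i))) (1\<^sub>m (nn (tgt i))) *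
          four_block_mat (A i) (C i) (0\<^sub>m (nn (tgt i)) (mm (src i))) (B i)"
        unfolding AX using A[OF i] B[OF i] C[OF i] Xt
        by (subst mult_four_block_mat[where ?nr1.0 = "mm (tgt i)" and ?nr2.0 = "nn (tgt i)" and ?n1.0 = "mm (tgt i)"
              and ?n2.0 = "nn (tgt i)" and ?nc1.0 = "mm (src i)" and ?nc2.0 = "nn (src i)"]) auto
      finally show ?thesis
        unfolding P_def angle_exp_unitriangular[OF X[OF i't(1)[OF i]]] angle_exp_unitriangular[OF X[OF i't(2)[OF i]]] dims
        using A[OF i] B[OF i] by simp
    qed
    ultimately show ?equivalent by blast
  next
    assume ?equivalent
    then obtain P where P: "\<And>j. j \<in> {1..t} \<Longrightarrow> P j \<in> carrier_mat (m j + n j) (m j + n j)"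
      and inv: "\<And>j. j \<in> {1..t} \<Longrightarrow> invertible_mat (P j)"
      and eq: "\<And>i. i \<in> {1..s} \<Longrightarrow>
               four_block_mat (A i) (0\<^sub>m (dim_row (A i)) (dim_col (B i)))
                              (0\<^sub>m (dim_row (B i)) (dim_col (A i))) (B i)
                 * angle_exp cmp crc (m (i' i)) (n (i' i)) (P (i' i)) (\<epsilon> i)
               = angle_exp cmp crc (m (i'' i)) (n (i'' i)) (P (i'' i)) (\<delta> i)
                 * four_block_mat (A i) (C i)
                              (0\<^sub>m (dim_row (B i)) (dim_col (A i))) (B i)" by blast
    have "\<exists>W. \<forall>j\<in>{1..t}. W j \<in> carrier_mat (m j + n j) (m j + n j) \<and>
        P j * W j = 1\<^sub>m (m j + n j) \<and> W j * P j = 1\<^sub>m (m j + n j)"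
      by (intro bchoice ballI) (metis invertible_matE[OF inv P])
    then obtain W where W: "\<And>j. j \<in> {1..t} \<Longrightarrow> W j \<in> carrier_mat (m j + n j) (m j + n j)"
      "\<And>j. j \<in> {1..t} \<Longrightarrow> P j * W j = 1\<^sub>m (m j + n j)" "\<And>j. j \<in> {1..t} \<Longrightarrow> W j * P j = 1\<^sub>m (m j + n j)"
      by blast
    \<comment> \<open>\<open>R' v\<close> is the inverse of \<open>R v\<close>. As
      \<open>bar\<close> is built on the inverse matrix, the daggered copy of \<open>P\<close> uses
      \<open>W\<close>, and its inverse uses \<open>P\<close>.\<close>
    define R R' where "R v = (if snd v then bar (m (fst v)) (n (fst v)) (W (fst v)) else P (fst v))"
      and "R' v = (if snd v then bar (m (fst v)) (n (fst v)) (P (fst v)) else W (fst v))" for v :: "nat \<times> bool"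
    define dual :: "nat \<times> bool \<Rightarrow> nat \<times> bool" where "dual v = (fst v, \<not> snd v)" for v
    have dual: "mm (dual v) = nn v" "nn (dual v) = mm v" "fst (dual v) = fst v" "snd (dual v) = (\<not> snd v)" for v
      by (simp_all add: dual_def mm_def nn_def)
    let ?V = "{1..t} \<times> (UNIV :: bool set)"
    have inV: "fst v \<in> {1..t}" if "v \<in> ?V" for v using that by auto
    have st: "src i \<in> ?V" "tgt i \<in> ?V" "dual (src i) \<in> ?V" "dual (tgt i) \<in> ?V" if "i \<in> {1..s}" for i
      using i't[OF that] by (auto simp: src_def tgt_def dual_def)
    have mn: "mm v + nn v = m (fst v) + n (fst v)" for v by (simp add: mm_def nn_def)
    have R: "R v \<in> carrier_mat (mm v + nn v) (mm v + nn v)" "R' v \<in> carrier_mat (mm v + nn v) (mm v + nn v)"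
      "R v * R' v = 1\<^sub>m (mm v + nn v)" "R' v * R v = 1\<^sub>m (mm v + nn v)" if "v \<in> ?V" for v
      unfolding mn R_def R'_def
      using P[OF inV[OF that]] W[OF inV[OF that]] by (simp_all add: bar_mult)
    have bar_R': "bar (mm v) (nn v) (twist_mat (twist (snd v)) b (R' v)) =
        twist_mat (twist (snd (dual v))) b (R (dual v))" if "v \<in> ?V" for v b
      using bar_twist[OF P[OF inV[OF that]] W(1)[OF inV[OF that]]]
      by (auto simp: mm_def nn_def R_def R'_def dual_def twist_def)
    have tinv: "twist_mat (twist c) b (R v) * twist_mat (twist c) b (R' v) = 1\<^sub>m (mm v + nn v)"
      "twist_mat (twist c) b (R' v) * twist_mat (twist c) b (R v) = 1\<^sub>m (mm v + nn v)" if "v \<in> ?V" for v b c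
      using twist_mat_inverse[OF twist_hom] R[OF that] by blast+
    have eq1: "four_block_mat (A i) (0\<^sub>m (mm (tgt i)) (nn (src i))) (0\<^sub>m (nn (tgt i)) (mm (src i))) (B i) *
          twist_mat (twist (snd (src i))) (is_twisted (\<epsilon> i)) (R (src i)) =
        twist_mat (twist (snd (tgt i))) (is_twisted (\<delta> i)) (R (tgt i)) *
          four_block_mat (A i) (C i) (0\<^sub>m (nn (tgt i)) (mm (src i))) (B i)" if i: "i \<in> {1..s}" for i
    proof -
      have "angle_exp cmp crc (m (i' i)) (n (i' i)) (P (i' i)) (\<epsilon> i) =
          twist_mat (twist (snd (src i))) (is_twisted (\<epsilon> i)) (R (src i))"
        "angle_exp cmp crc (m (i'' i)) (n (i'' i)) (P (i'' i)) (\<delta> i) =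
          twist_mat (twist (snd (tgt i))) (is_twisted (\<delta> i)) (R (tgt i))"
        unfolding R_def src_def tgt_def fst_conv snd_conv
        by (rule angle_exp_twist[OF P W] i't[OF i])+
      then show ?thesis using eq[OF i] A[OF i] B[OF i] by simp
    qed
    \<comment> \<open>The dagger of \<open>eq1\<close>: source and target change places, and both
      pass to the opposite copy.\<close>
    have eq2: "four_block_mat (dg (B i)) (0\<^sub>m (nn (src i)) (mm (tgt i))) (0\<^sub>m (mm (src i)) (nn (tgt i))) (dg (A i)) *
          twist_mat (twist (snd (dual (tgt i)))) (is_twisted (\<delta> i)) (R (dual (tgt i))) =
        twist_mat (twist (snd (dual (src i)))) (is_twisted (\<epsilon> i)) (R (dual (src i))) *
          four_block_mat (dg (B i)) (- dg (C i)) (0\<^sub>m (mm (src i)) (nn (tgt i))) (dg (A i))" if i: "i \<in> {1..s}" for i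
      using dual_equation[OF A[OF i] B[OF i] C[OF i] _ _ tinv(1)[OF st(1)[OF i]] _ _ tinv(2)[OF st(2)[OF i]] eq1[OF i]]
        R(1,2)[OF st(1)[OF i]] R(1,2)[OF st(2)[OF i]]
      by (simp add: bar_R'[OF st(1)[OF i]] bar_R'[OF st(2)[OF i]])
    have two: "(2 :: 'a) \<noteq> 0" by (rule char_not_two[OF assms(1)])
    let ?I = "{1..s} \<times> (UNIV :: bool set)"
    \<comment> \<open>Index \<open>(i, True)\<close> is the daggered version of equation
      \<open>i\<close>: \<open>A\<close> and \<open>B\<close>, \<open>src\<close> and
      \<open>tgt\<close>, and the two exponents trade places, and \<open>C\<close> becomes
      \<open>- dg C\<close>.\<close>
    define src2 tgt2 where "src2 k = (if snd k then dual (tgt (fst k)) else src (fst k))"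
      and "tgt2 k = (if snd k then dual (src (fst k)) else tgt (fst k))" for k :: "nat \<times> bool"
    define \<epsilon>2 \<delta>2 where "\<epsilon>2 k = is_twisted (if snd k then \<delta> (fst k) else \<epsilon> (fst k))"
      and "\<delta>2 k = is_twisted (if snd k then \<epsilon> (fst k) else \<delta> (fst k))" for k :: "nat \<times> bool"
    define A2 B2 C2 where "A2 k = (if snd k then dg (B (fst k)) else A (fst k))"
      and "B2 k = (if snd k then dg (A (fst k)) else B (fst k))"
      and "C2 k = (if snd k then - dg (C (fst k)) else C (fst k))" for k :: "nat \<times> bool"
    note defs2 = src2_def tgt2_def \<epsilon>2_def \<delta>2_def A2_def B2_def C2_def
    have "\<exists>X. (\<forall>v\<in>?V. X v \<in> carrier_mat (mm v) (nn v)) \<and>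
      (\<forall>k\<in>?I. A2 k * twist_mat (twist (snd (src2 k))) (\<epsilon>2 k) (X (src2 k)) -
        twist_mat (twist (snd (tgt2 k))) (\<delta>2 k) (X (tgt2 k)) * B2 k = C2 k)"
    proof (rule twisted_roth[where \<tau> = "\<lambda>v. twist (snd v)" and Va = "{1..t} \<times> {False}" and Vb = "{1..t} \<times> {True}"
          and \<phi> = cmp and \<psi> = cmp' and P = R and P' = R'])
      show "{1..t} \<times> {False} \<union> {1..t} \<times> {True} = ?V" by auto
      show "four_block_mat (A2 k) (0\<^sub>m (mm (tgt2 k)) (nn (src2 k))) (0\<^sub>m (nn (tgt2 k)) (mm (src2 k))) (B2 k) *
          twist_mat (twist (snd (src2 k))) (\<epsilon>2 k) (R (src2 k)) =
        twist_mat (twist (snd (tgt2 k))) (\<delta>2 k) (R (tgt2 k)) *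
          four_block_mat (A2 k) (C2 k) (0\<^sub>m (nn (tgt2 k)) (mm (src2 k))) (B2 k)" if "k \<in> ?I" for k
        using that eq1[of "fst k"] eq2[of "fst k"] by (cases k; cases "snd k") (auto simp: defs2 dual)
      show "A2 k \<in> carrier_mat (mm (tgt2 k)) (mm (src2 k))" "B2 k \<in> carrier_mat (nn (tgt2 k)) (nn (src2 k))"
        "C2 k \<in> carrier_mat (mm (tgt2 k)) (nn (src2 k))" if "k \<in> ?I" for k
        using that A[of "fst k"] B[of "fst k"] C[of "fst k"] by (auto simp: defs2 dual)
      show "src2 k \<in> ?V" "tgt2 k \<in> ?V" if "k \<in> ?I" for k
        using that st[of "fst k"] by (auto simp: defs2)
    qed (use R two assms(2) cmp_facts cmp'_facts in \<open>auto simp: twist_def\<close>)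
    then obtain X where X: "\<And>v. v \<in> ?V \<Longrightarrow> X v \<in> carrier_mat (mm v) (nn v)"
      and X_eq: "\<And>k. k \<in> ?I \<Longrightarrow> A2 k * twist_mat (twist (snd (src2 k))) (\<epsilon>2 k) (X (src2 k)) -
        twist_mat (twist (snd (tgt2 k))) (\<delta>2 k) (X (tgt2 k)) * B2 k = C2 k" by blast
    \<comment> \<open>The copies are solved independently, so \<open>X (j, True)\<close> need not be
      the dagger of \<open>X (j, False)\<close>; averaging reconciles them.\<close>
    define Y where "Y j = avg (X (j, False)) (dg (X (j, True)))" for j
    have XF: "X (j, False) \<in> carrier_mat (m j) (n j)" and XT: "X (j, True) \<in> carrier_mat (n j) (m j)"
      if "j \<in> {1..t}" for j
      using X[of "(j, False)"] X[of "(j, True)"] that by (simp_all add: mm_def nn_def)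
    have "A i * mat_exp cmp crc (Y (i' i)) (\<epsilon> i) - mat_exp cmp crc (Y (i'' i)) (\<delta> i) * B i = C i"
      if i: "i \<in> {1..s}" for i
    proof -
      let ?S = "twist_mat (twist (snd (src i))) (is_twisted (\<epsilon> i)) (X (src i))"
      let ?T = "twist_mat (twist (snd (tgt i))) (is_twisted (\<delta> i)) (X (tgt i))"
      let ?S' = "twist_mat (twist (snd (dual (src i)))) (is_twisted (\<epsilon> i)) (X (dual (src i)))"
      let ?T' = "twist_mat (twist (snd (dual (tgt i)))) (is_twisted (\<delta> i)) (X (dual (tgt i)))"
      have car: "?S \<in> carrier_mat (mm (src i)) (nn (src i))" "?T \<in> carrier_mat (mm (tgt i)) (nn (tgt i))"
        "?S' \<in> carrier_mat (nn (src i)) (mm (src i))" "?T' \<in> carrier_mat (nn (tgt i)) (mm (tgt i))"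
        using X[OF st(1)[OF i]] X[OF st(2)[OF i]] X[OF st(3)[OF i]] X[OF st(4)[OF i]] by (simp_all add: dual)
      have dcar: "dg ?S' \<in> carrier_mat (mm (src i)) (nn (src i))" "dg ?T' \<in> carrier_mat (mm (tgt i)) (nn (tgt i))"
        using car by simp_all
      have Ye: "mat_exp cmp crc (Y (i' i)) (\<epsilon> i) = avg ?S (dg ?S')" "mat_exp cmp crc (Y (i'' i)) (\<delta> i) = avg ?T (dg ?T')"
        unfolding Y_def mat_exp_avg[OF two XF XT, OF i't(1)[OF i] i't(1)[OF i]]
          mat_exp_avg[OF two XF XT, OF i't(2)[OF i] i't(2)[OF i]]
        by (auto simp: src_def tgt_def dual_def)
      have e1: "A i * ?S - ?T * B i = C i"
        using X_eq[of "(i, False)"] i by (simp add: defs2)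
      \<comment> \<open>Daggering the dual equation shows that \<open>dg ?S'\<close> and
        \<open>dg ?T'\<close> satisfy the same equation as \<open>?S\<close> and
        \<open>?T\<close>.\<close>
      have e2: "A i * dg ?S' - dg ?T' * B i = C i"
      proof -
        have "dg (B i) * ?T' - ?S' * dg (A i) = - dg (C i)"
          using X_eq[of "(i, True)"] i by (simp add: defs2)
        then have "dg (dg (B i) * ?T' - ?S' * dg (A i)) = - C i"
          by (simp add: dg_simps)
        moreover have BT: "dg (B i) * ?T' \<in> carrier_mat (nn (src i)) (mm (tgt i))"
          and SA: "?S' * dg (A i) \<in> carrier_mat (nn (src i)) (mm (tgt i))"
          using car A[OF i] B[OF i] by auto
        moreover have "dg (dg (B i) * ?T') = dg ?T' * B i" "dg (?S' * dg (A i)) = A i * dg ?S'"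
          using dg_mult[of "dg (B i)" "nn (src i)" "nn (tgt i)" ?T' "mm (tgt i)"]
            dg_mult[of ?S' "nn (src i)" "mm (src i)" "dg (A i)" "mm (tgt i)"] car A[OF i] B[OF i]
          by simp_all
        ultimately have e: "dg ?T' * B i - A i * dg ?S' = - C i"
          using dg_minus[OF BT SA] by simp
        have "dg ?T' * B i \<in> carrier_mat (mm (tgt i)) (nn (src i))" "A i * dg ?S' \<in> carrier_mat (mm (tgt i)) (nn (src i))"
          using dcar A[OF i] B[OF i] by auto
        then have "A i * dg ?S' - dg ?T' * B i = - (dg ?T' * B i - A i * dg ?S')"
          by (intro diff_mat_swap)
        also have "\<dots> = C i" unfolding e by (rule eq_matI) auto
        finally show ?thesis .
      qed
      \<comment> \<open>The left side is additive and commutes with halving, so averaging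
        \<open>e1\<close> and \<open>e2\<close> gives the equation for \<open>Y\<close>.\<close>
      have "A i * avg ?S (dg ?S') - avg ?T (dg ?T') * B i =
          avg (A i * ?S) (A i * dg ?S') - avg (?T * B i) (dg ?T' * B i)"
        using mult_avg[OF two A[OF i] car(1) dcar(1)] avg_mult[OF B[OF i] car(2) dcar(2)] by simp
      also have "\<dots> = avg (A i * ?S - ?T * B i) (A i * dg ?S' - dg ?T' * B i)"
        using A[OF i] B[OF i] car dcar by (intro avg_diff[of _ "mm (tgt i)" "nn (src i)"]) (auto simp del: dg_carrier)
      also have "\<dots> = C i" unfolding e1 e2 by (rule avg_self[OF two])
      finally show ?thesis unfolding Ye .
    qed
    moreover have "Y j \<in> carrier_mat (m j) (n j)" if "j \<in> {1..t}" for j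
      using XF[OF that] XT[OF that] by (simp add: Y_def)
    ultimately show ?solvable by blast
  qed
qed

end
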